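(* Let $\ell\ge 1$ and let $\mathcal S_\ell$ be the variety of solvable groups of length at most $\ell$. Let $G\cong \mathbf Z^{(m)}\oplus \mathbf Z_{n_1}\oplus \mathbf Z_{n_2}\oplus\cdots\oplus \mathbf Z_{n_k}$ be a finitely generated abelian group, where $m,k\ge 0$, the $n_i$ are positive integers, and $n_{i+1}\mid n_i$ for all $1\le i\le k-1$. Then $$\mathcal S_\ell M(G)\cong \mathbf Z^{(h_m)}\oplus \mathbf Z_{n_1}^{(h_{m+1}-h_m)}\oplus\cdots\oplus \mathbf Z_{n_k}^{(h_{m+k}-h_{m+k-1})},$$ where $h_i=\chi_2(\cdots(\chi_2(i))\cdots)$, with $\chi_2$ applied $\ell$ times, for all $m\le i\le m+k$.
   Context: $\mathbf Z_n$ is the cyclic group of order $n$, and $A^{(r)}$ denotes the direct sum of $r$ copies of $A$. $\chi_2(d)$ is the number of basic commutators of weight $2$ on $d$ letters, i.e. $\chi_2(d)=\frac12(d^2-d)$. Baer invariant: let $G\cong F/R$ be a free presentation, $F$ a free group. For a variety $\mathcal V$ with set of words $V$, $\mathcal VM(G)=\dfrac{R\cap V(F)}{[RV^*F]}$, where $V(F)$ is the verbal subgroup of $F$ and $[RV^*F]$ is the subgroup generated by all $v(f_1,\ldots,f_ir,\ldots,f_n)\,v(f_1,\ldots,f_i,\ldots,f_n)^{-1}$ with $r\in R$, $v\in V$, $f_j\in F$, $1\le i\le n$, $n\in\mathbf N$. Up to isomorphism this depends only on $G$ and $\mathcal V$. For $\mathcal V=\mathcal S_\ell$ it is known that this equals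 $$\mathcal S_\ell M(G)=\frac{R\cap\delta^\ell(F)}{[R,F,\delta^1(F),\ldots,\delta^{\ell-1}(F)]},$$ where $\delta^i(F)$ is the $i$-th derived subgroup of $F$ and commutators of subgroups are left-normed ($[A,B,C]=[[A,B],C]$, etc.); for $\ell=1$ the denominator is $[R,F]$. *)

theory Defs
  imports "HOL-Algebra.Algebra" "HOL-Library.Countable_Set"
begin

section \<open>Words and free groups\<close>

text \<open>The letter \<open>(True, x)\<close> stands for \<open>x\<close> and \<open>(False, x)\<close> for its formal inverse. Words
  need not be reduced.\<close>

type_synonym 'x word = "(bool \<times> 'x) list"

primrec word_val :: "('a, 'b) monoid_scheme \<Rightarrow> ('x \<Rightarrow> 'a) \<Rightarrow> 'x word \<Rightarrow> 'a" where
  "word_val G f [] = \<one>\<^bsub>G\<^esub>"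
| "word_val G f (a # w) = (if fst a then f (snd a) else inv\<^bsub>G\<^esub> f (snd a)) \<otimes>\<^bsub>G\<^esub> word_val G f w"

definition cancels :: "bool \<times> 'x \<Rightarrow> bool \<times> 'x \<Rightarrow> bool" where
  "cancels a b \<longleftrightarrow> snd a = snd b \<and> fst a \<noteq> fst b"

definition reduced :: "'x word \<Rightarrow> bool" where
  "reduced w \<longleftrightarrow> successively (\<lambda>a b. \<not> cancels a b) w"

text \<open>\<open>G\<close> is free on \<open>S\<close> if every element is the value of exactly one reduced word in the letters
  \<open>S\<close> and their inverses. Quantifying over groups of arbitrary type is not possible inside a
  definition, so the universal property is the lemma \<open>free_basis_universal\<close> below.\<close>

definition free_basis :: "('a, 'b) monoid_scheme \<Rightarrow> 'a set \<Rightarrow> bool" where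
  "free_basis G S \<longleftrightarrow> S \<subseteq> carrier G \<and>
     bij_betw (word_val G (\<lambda>x. x)) {w. reduced w \<and> snd ` set w \<subseteq> S} (carrier G)"

definition free_group :: "('a, 'b) monoid_scheme \<Rightarrow> bool" where
  "free_group G \<longleftrightarrow> group G \<and> (\<exists>S. free_basis G S)"

definition free_presentation ::
    "('f, 'b) monoid_scheme \<Rightarrow> 'f set \<Rightarrow> ('g, 'c) monoid_scheme \<Rightarrow> bool" where
  "free_presentation F R G \<longleftrightarrow> free_group F \<and> R \<lhd> F \<and> G \<cong> F Mod R"


section \<open>Varieties and Baer invariants\<close>

text \<open>A set of words \<open>V\<close> in the variables \<open>x\<^sub>0, x\<^sub>1, \<dots>\<close> is evaluated at all assignments of group
  elements to all the variables; a word only depends on the finitely many variables occurring in it.\<close>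

definition satisfies_laws :: "('a, 'b) monoid_scheme \<Rightarrow> nat word set \<Rightarrow> bool" where
  "satisfies_laws G V \<longleftrightarrow> (\<forall>v\<in>V. \<forall>f \<in> UNIV \<rightarrow> carrier G. word_val G f v = \<one>\<^bsub>G\<^esub>)"

definition verbal_subgroup :: "('a, 'b) monoid_scheme \<Rightarrow> nat word set \<Rightarrow> 'a set" where
  "verbal_subgroup G V = generate G {word_val G f v | f v. v \<in> V \<and> f \<in> UNIV \<rightarrow> carrier G}"

text \<open>The subgroup \<open>[R V\<^sup>* F]\<close>. If \<open>x\<^sub>i\<close> does not occur in \<open>v\<close>, the generator is trivial.\<close>

definition baer_commutator :: "('a, 'b) monoid_scheme \<Rightarrow> 'a set \<Rightarrow> nat word set \<Rightarrow> 'a set" where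
  "baer_commutator F R V = generate F
     {word_val F (f(i := f i \<otimes>\<^bsub>F\<^esub> r)) v \<otimes>\<^bsub>F\<^esub> inv\<^bsub>F\<^esub> word_val F f v | f i r v.
        f \<in> UNIV \<rightarrow> carrier F \<and> r \<in> R \<and> v \<in> V}"

definition baer_invariant ::
    "('a, 'b) monoid_scheme \<Rightarrow> 'a set \<Rightarrow> nat word set \<Rightarrow> 'a set monoid" where
  "baer_invariant F R V =
     F\<lparr>carrier := R \<inter> verbal_subgroup F V\<rparr> Mod baer_commutator F R V"

definition derived_length_le :: "('a, 'b) monoid_scheme \<Rightarrow> nat \<Rightarrow> bool" where
  "derived_length_le G l \<longleftrightarrow> (derived G ^^ l) (carrier G) = {\<one>\<^bsub>G\<^esub>}"

text \<open>\<open>V\<close> is a set of words for the variety of solvable groups of length at most \<open>l\<close>. A law involves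
  finitely many variables, so it suffices to test groups with carrier in \<open>nat\<close>: the lemma
  \<open>defines_solvable_variety_iff\<close> below gives the equivalence for groups of every type, and
  \<open>ex_defines_solvable_variety\<close> provides such a \<open>V\<close>.\<close>

definition defines_solvable_variety :: "nat word set \<Rightarrow> nat \<Rightarrow> bool" where
  "defines_solvable_variety V l \<longleftrightarrow>
     (\<forall>H :: nat monoid. group H \<longrightarrow> (satisfies_laws H V \<longleftrightarrow> derived_length_le H l))"


section \<open>Direct powers and the exponents\<close>

definition direct_power :: "('a, 'b) monoid_scheme \<Rightarrow> nat \<Rightarrow> (nat \<Rightarrow> 'a) monoid" where
  "direct_power A r = sum_group {..<r} (\<lambda>_. A)"

definition chi2 :: "nat \<Rightarrow> nat" where
  "chi2 d = (d\<^sup>2 - d) div 2"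

definition h_exp :: "nat \<Rightarrow> nat \<Rightarrow> nat" where
  "h_exp l i = (chi2 ^^ l) i"

text \<open>Hence the truncated differences \<open>h_exp l (i + 1) - h_exp l i\<close> are genuine differences.\<close>

lemma mono_h_exp: "mono (h_exp l)"
proof -
  have "mono chi2"
  proof (rule mono_iff_le_Suc[THEN iffD2], rule allI)
    fix d
    have "(Suc d)\<^sup>2 - Suc d = (d\<^sup>2 - d) + 2 * d"
      by (cases d) (simp_all add: power2_eq_square)
    then show "chi2 d \<le> chi2 (Suc d)"
      unfolding chi2_def by (intro div_le_mono) linarith
  qed
  then show ?thesis
    unfolding h_exp_def by (induction l) (auto simp: mono_def)
qed


section \<open>The universal property of free groups\<close>

lemma word_val_cong:
  "(\<And>x. x \<in> snd ` set w \<Longrightarrow> f x = g x) \<Longrightarrow> word_val G f w = word_val G g w"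
  by (induction w) auto

context group
begin

lemma word_val_closed:
  "(\<And>x. x \<in> snd ` set w \<Longrightarrow> f x \<in> carrier G) \<Longrightarrow> word_val G f w \<in> carrier G"
  by (induction w) auto

lemma word_val_append:
  assumes "\<And>x. x \<in> snd ` set u \<Longrightarrow> f x \<in> carrier G" "\<And>x. x \<in> snd ` set w \<Longrightarrow> f x \<in> carrier G"
  shows "word_val G f (u @ w) = word_val G f u \<otimes> word_val G f w"
  using assms
proof (induction u)
  case (Cons a u)
  have "word_val G f u \<in> carrier G" "word_val G f w \<in> carrier G" "f (snd a) \<in> carrier G"
    using Cons.prems by (auto intro!: word_val_closed)
  with Cons show ?case
    by (auto simp: m_assoc)
qed (auto simp: word_val_closed)

end

lemma word_val_hom:
  assumes "group G" "group H" "h \<in> hom G H" "\<And>x. x \<in> snd ` set w \<Longrightarrow> f x \<in> carrier G"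
  shows "h (word_val G f w) = word_val H (h \<circ> f) w"
proof -
  interpret group_hom G H h
    using assms by (simp add: group_hom_def group_hom_axioms_def)
  show ?thesis
    using assms(4)
  proof (induction w)
    case (Cons a w)
    have "word_val G f w \<in> carrier G" "f (snd a) \<in> carrier G"
      using Cons.prems by (auto intro!: G.word_val_closed)
    with Cons show ?case by auto
  qed auto
qed

fun reduce :: "'x word \<Rightarrow> 'x word" where
  "reduce [] = []"
| "reduce (a # w) =
    (case reduce w of [] \<Rightarrow> [a] | b # u \<Rightarrow> if cancels a b then u else a # b # u)"

lemma reduced_reduce: "reduced (reduce w)"
  by (induction w) (auto simp: reduced_def successively_Cons split: list.splits)

lemma set_reduce: "set (reduce w) \<subseteq> set w"
  by (induction w) (fastforce split: list.splits if_splits)+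

lemma (in group) word_val_reduce:
  assumes "\<And>x. x \<in> snd ` set w \<Longrightarrow> f x \<in> carrier G"
  shows "word_val G f (reduce w) = word_val G f w"
  using assms
proof (induction w)
  case (Cons a w)
  have IH: "word_val G f (reduce w) = word_val G f w"
    using Cons by auto
  show ?case
  proof (cases "reduce w")
    case Nil
    with IH show ?thesis by auto
  next
    case (Cons b u)
    have "snd ` set (b # u) \<subseteq> snd ` set w"
      using set_reduce[of w] Cons by auto
    then have "f (snd b) \<in> carrier G" "word_val G f u \<in> carrier G"
      using Cons.prems by (auto intro!: word_val_closed)
    moreover have "f (snd a) \<in> carrier G"
      using Cons.prems by auto
    ultimately show ?thesis
      using IH[symmetric] Cons
      by (auto simp: cancels_def m_assoc[symmetric])
  qed
qed auto

lemma free_basis_universal: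
  assumes F: "group F" "free_basis F S" and H: "group H" "f \<in> S \<rightarrow> carrier H"
  shows "\<exists>h \<in> hom F H. \<forall>s\<in>S. h s = f s"
proof -
  interpret F: group F by fact
  interpret H: group H by fact
  let ?W = "{w. reduced w \<and> snd ` set w \<subseteq> S}"
  let ?ev = "word_val F (\<lambda>x. x)"
  have S: "S \<subseteq> carrier F" and bij: "bij_betw ?ev ?W (carrier F)"
    using F by (auto simp: free_basis_def)
  define nf where "nf = the_inv_into ?W ?ev"
  have inj: "inj_on ?ev ?W"
    using bij by (rule bij_betw_imp_inj_on)
  have nf: "nf g \<in> ?W" "?ev (nf g) = g" if "g \<in> carrier F" for g
    using that bij the_inv_into_into[OF inj, of g ?W] f_the_inv_into_f[OF inj, of g]
    by (auto simp: nf_def bij_betw_def)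
  have nf_unique: "nf (?ev w) = w" if "w \<in> ?W" for w
    unfolding nf_def by (rule the_inv_into_f_f[OF inj that])
  define h where "h g = word_val H f (nf g)" for g
  have fH: "f x \<in> carrier H" if "x \<in> snd ` set w" "snd ` set w \<subseteq> S" for x w
    using that H by auto
  have "h \<in> hom F H"
  proof (rule homI)
    fix x assume "x \<in> carrier F"
    then show "h x \<in> carrier H"
      unfolding h_def using nf(1)[of x] by (intro H.word_val_closed fH[of _ "nf x"]) auto
  next
    fix x y assume x: "x \<in> carrier F" and y: "y \<in> carrier F"
    let ?u = "nf x" and ?v = "nf y"
    have uS: "snd ` set (?u @ ?v) \<subseteq> S"
      using nf(1)[OF x] nf(1)[OF y] by auto
    have "reduce (?u @ ?v) \<in> ?W"
      using reduced_reduce set_reduce[of "?u @ ?v"] uS by blast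
    then have "nf (?ev (reduce (?u @ ?v))) = reduce (?u @ ?v)"
      by (rule nf_unique)
    moreover have "?ev (reduce (?u @ ?v)) = x \<otimes>\<^bsub>F\<^esub> y"
    proof -
      have "?ev (reduce (?u @ ?v)) = ?ev (?u @ ?v)"
        using uS S by (intro F.word_val_reduce) auto
      also have "\<dots> = ?ev ?u \<otimes>\<^bsub>F\<^esub> ?ev ?v"
        using uS S by (intro F.word_val_append) auto
      finally show ?thesis using nf(2) x y by simp
    qed
    ultimately have "nf (x \<otimes>\<^bsub>F\<^esub> y) = reduce (?u @ ?v)"
      by simp
    then have "h (x \<otimes>\<^bsub>F\<^esub> y) = word_val H f (reduce (?u @ ?v))"
      by (simp add: h_def)
    also have "\<dots> = word_val H f (?u @ ?v)"
      using uS H by (intro H.word_val_reduce) auto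
    also have "\<dots> = h x \<otimes>\<^bsub>H\<^esub> h y"
      unfolding h_def using uS H by (intro H.word_val_append) auto
    finally show "h (x \<otimes>\<^bsub>F\<^esub> y) = h x \<otimes>\<^bsub>H\<^esub> h y" .
  qed
  moreover have "h s = f s" if "s \<in> S" for s
  proof -
    have "nf s = [(True, s)]"
      using nf_unique[of "[(True, s)]"] that S by (auto simp: reduced_def)
    then show ?thesis
      using that H by (simp add: h_def Pi_iff)
  qed
  ultimately show ?thesis by blast
qed


section \<open>Words for the variety of solvable groups\<close>

definition inv_word :: "'x word \<Rightarrow> 'x word" where
  "inv_word w = rev (map (\<lambda>a. (\<not> fst a, snd a)) w)"

fun derived_word :: "nat \<Rightarrow> nat \<Rightarrow> nat word" where
  "derived_word 0 j = [(True, j)]"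
| "derived_word (Suc l) j =
    (let u = derived_word l (2 * j); v = derived_word l (2 * j + 1)
     in u @ v @ inv_word u @ inv_word v)"

lemma set_inv_word [simp]: "snd ` set (inv_word w) = snd ` set w"
  by (force simp: inv_word_def image_image)

lemma (in group) word_val_inv_word:
  assumes "\<And>x. x \<in> snd ` set w \<Longrightarrow> f x \<in> carrier G"
  shows "word_val G f (inv_word w) = inv word_val G f w"
  using assms
proof (induction w)
  case (Cons a w)
  have cl: "word_val G f w \<in> carrier G" "f (snd a) \<in> carrier G"
    using Cons.prems by (auto intro!: word_val_closed)
  have "word_val G f (inv_word (a # w)) = word_val G f (inv_word w @ [(\<not> fst a, snd a)])"
    by (simp add: inv_word_def)
  also have "\<dots> = word_val G f (inv_word w) \<otimes> word_val G f [(\<not> fst a, snd a)]"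
    using Cons.prems by (intro word_val_append) auto
  finally show ?case
    using Cons cl by (auto simp: inv_mult_group)
qed (auto simp: inv_word_def)

lemma derived_word_vars:
  "x \<in> snd ` set (derived_word l j) \<Longrightarrow> j * 2 ^ l \<le> x \<and> x < (j + 1) * 2 ^ l"
proof (induction l arbitrary: j)
  case (Suc l)
  have "snd ` set (derived_word (Suc l) j) =
      snd ` set (derived_word l (2 * j)) \<union> snd ` set (derived_word l (2 * j + 1))"
    by (simp only: derived_word.simps Let_def set_append image_Un set_inv_word) blast
  then have "x \<in> snd ` set (derived_word l (2 * j)) \<or> x \<in> snd ` set (derived_word l (2 * j + 1))"
    using Suc.prems by blast
  then show ?case
    using Suc.IH[of "2 * j"] Suc.IH[of "2 * j + 1"]
    by (elim disjE) (simp_all add: algebra_simps)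
qed auto

lemma (in group) derived_word_values:
  "{word_val G f (derived_word l j) | f. f \<in> UNIV \<rightarrow> carrier G} = (derived_set G ^^ l) (carrier G)"
proof (induction l arbitrary: j)
  case 0
  have "g \<in> {f j \<otimes> \<one> | f. f \<in> UNIV \<rightarrow> carrier G}" if "g \<in> carrier G" for g
    using that by (auto intro!: exI[of _ "\<lambda>_. g"])
  then show ?case by (auto simp: Pi_iff)
next
  case (Suc l)
  let ?u = "derived_word l (2 * j)" and ?v = "derived_word l (2 * j + 1)"
  have val: "word_val G f (derived_word (Suc l) j) =
      word_val G f ?u \<otimes> word_val G f ?v \<otimes> inv word_val G f ?u \<otimes> inv word_val G f ?v"
    if "f \<in> UNIV \<rightarrow> carrier G" for f
  proof -
    have f: "f x \<in> carrier G" for x using that by auto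
    show ?thesis
      by (simp add: Let_def word_val_append word_val_inv_word word_val_closed f m_assoc)
  qed
  show ?case
  proof (intro equalityI subsetI)
    fix g assume "g \<in> {word_val G f (derived_word (Suc l) j) | f. f \<in> UNIV \<rightarrow> carrier G}"
    then obtain f where f: "f \<in> UNIV \<rightarrow> carrier G" "g = word_val G f (derived_word (Suc l) j)"
      by blast
    have "word_val G f ?u \<in> (derived_set G ^^ l) (carrier G)"
         "word_val G f ?v \<in> (derived_set G ^^ l) (carrier G)"
      using f(1) Suc.IH by blast+
    then show "g \<in> (derived_set G ^^ Suc l) (carrier G)"
      unfolding f(2) val[OF f(1)] by auto
  next
    fix g assume "g \<in> (derived_set G ^^ Suc l) (carrier G)"
    then obtain a b where ab: "a \<in> (derived_set G ^^ l) (carrier G)"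
        "b \<in> (derived_set G ^^ l) (carrier G)" "g = a \<otimes> b \<otimes> inv a \<otimes> inv b"
      by auto
    obtain f1 where f1: "f1 \<in> UNIV \<rightarrow> carrier G" "a = word_val G f1 ?u"
      using ab(1) Suc.IH[of "2 * j"] by blast
    obtain f2 where f2: "f2 \<in> UNIV \<rightarrow> carrier G" "b = word_val G f2 ?v"
      using ab(2) Suc.IH[of "2 * j + 1"] by blast
    define f where "f x = (if x < (2 * j + 1) * 2 ^ l then f1 x else f2 x)" for x
    have f: "f \<in> UNIV \<rightarrow> carrier G"
      using f1 f2 by (auto simp: f_def Pi_iff)
    have "word_val G f ?u = a"
      unfolding f1 using derived_word_vars[of _ l "2 * j"]
      by (intro word_val_cong) (auto simp: f_def)
    moreover have "word_val G f ?v = b"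
      unfolding f2 using derived_word_vars[of _ l "2 * j + 1"]
      by (intro word_val_cong) (fastforce simp: f_def)
    ultimately have "g = word_val G f (derived_word (Suc l) j)"
      using val[OF f] ab(3) by simp
    then show "g \<in> {word_val G f (derived_word (Suc l) j) | f. f \<in> UNIV \<rightarrow> carrier G}"
      using f by blast
  qed
qed

lemma (in group) commutator_conj:
  assumes "g \<in> carrier G" "a \<in> carrier G" "b \<in> carrier G"
  shows "g \<otimes> (a \<otimes> b \<otimes> inv a \<otimes> inv b) \<otimes> inv g =
    (g \<otimes> a \<otimes> inv g) \<otimes> (g \<otimes> b \<otimes> inv g) \<otimes> inv (g \<otimes> a \<otimes> inv g) \<otimes> inv (g \<otimes> b \<otimes> inv g)"
proof -
  have "inv g \<otimes> (g \<otimes> x) = x" if "x \<in> carrier G" for x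
    using assms that by (simp add: m_assoc[symmetric])
  then show ?thesis
    using assms by (simp add: inv_mult_group m_assoc)
qed

lemma (in group) inv_comm_commutes:
  assumes "a \<in> carrier G" "c \<in> carrier G" "a \<otimes> c = c \<otimes> a"
  shows "inv a \<otimes> c = c \<otimes> inv a"
proof -
  have "inv a \<otimes> c = inv a \<otimes> (c \<otimes> a) \<otimes> inv a"
    using assms(1,2) by (simp add: m_assoc)
  also have "\<dots> = inv a \<otimes> (a \<otimes> c) \<otimes> inv a"
    by (simp only: assms(3))
  also have "\<dots> = c \<otimes> inv a"
    using assms(1,2) by (simp add: m_assoc[symmetric])
  finally show ?thesis .
qed

lemma (in group) derived_generate:
  assumes S: "S \<subseteq> carrier G" and conj: "\<And>s g. s \<in> S \<Longrightarrow> g \<in> carrier G \<Longrightarrow> g \<otimes> s \<otimes> inv g \<in> S"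
  shows "derived G (generate G S) = generate G (derived_set G S)"
proof
  let ?N = "generate G (derived_set G S)"
  have dS: "derived_set G S \<subseteq> carrier G"
    by (rule derived_set_in_carrier[OF S])
  have dconj: "g \<otimes> d \<otimes> inv g \<in> derived_set G S" if d: "d \<in> derived_set G S" and g: "g \<in> carrier G" for d g
  proof -
    obtain a b where ab: "a \<in> S" "b \<in> S" "d = a \<otimes> b \<otimes> inv a \<otimes> inv b"
      using d by auto
    have "g \<otimes> d \<otimes> inv g =
      (g \<otimes> a \<otimes> inv g) \<otimes> (g \<otimes> b \<otimes> inv g) \<otimes> inv (g \<otimes> a \<otimes> inv g) \<otimes> inv (g \<otimes> b \<otimes> inv g)"
      unfolding ab(3) using ab S g by (intro commutator_conj) auto
    then show ?thesis
      using conj[OF ab(1) g] conj[OF ab(2) g] by auto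
  qed
  have N: "?N \<lhd> G"
    by (rule normal_generateI[OF dS dconj])
  then interpret N: normal ?N G .
  let ?q = "\<lambda>x. ?N #> x"
  interpret Q: group "G Mod ?N" by (rule N.factorgroup_is_group)
  interpret q: group_hom G "G Mod ?N" ?q
    using N.r_coset_hom_Mod N.factorgroup_is_group
    by (simp add: group_hom_def group_hom_axioms_def is_group)
  have comm_iff: "a \<otimes> b \<otimes> inv a \<otimes> inv b \<in> ?N \<longleftrightarrow> ?q a \<otimes>\<^bsub>G Mod ?N\<^esub> ?q b = ?q b \<otimes>\<^bsub>G Mod ?N\<^esub> ?q a"
    if ab: "a \<in> carrier G" "b \<in> carrier G" for a b
  proof -
    have "a \<otimes> b \<otimes> inv a \<otimes> inv b \<in> ?N \<longleftrightarrow> ?q (a \<otimes> b \<otimes> inv a \<otimes> inv b) = \<one>\<^bsub>G Mod ?N\<^esub>"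
      using ab coset_join1[OF _ _ N.subgroup_axioms] coset_join2[OF _ N.subgroup_axioms]
      unfolding one_FactGroup by (meson inv_closed m_closed)
    also have "\<dots> \<longleftrightarrow> ?q a \<otimes>\<^bsub>G Mod ?N\<^esub> ?q b = ?q b \<otimes>\<^bsub>G Mod ?N\<^esub> ?q a"
    proof -
      let ?a = "?q a" and ?b = "?q b"
      have cl: "?a \<in> carrier (G Mod ?N)" "?b \<in> carrier (G Mod ?N)"
        using ab q.hom_closed by blast+
      have "?q (a \<otimes> b \<otimes> inv a \<otimes> inv b) = ?a \<otimes>\<^bsub>G Mod ?N\<^esub> ?b \<otimes>\<^bsub>G Mod ?N\<^esub>
          inv\<^bsub>G Mod ?N\<^esub> ?a \<otimes>\<^bsub>G Mod ?N\<^esub> inv\<^bsub>G Mod ?N\<^esub> ?b"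
        using ab by (simp only: q.hom_mult q.hom_inv m_closed inv_closed)
      also have "\<dots> = (?a \<otimes>\<^bsub>G Mod ?N\<^esub> ?b) \<otimes>\<^bsub>G Mod ?N\<^esub> inv\<^bsub>G Mod ?N\<^esub> (?b \<otimes>\<^bsub>G Mod ?N\<^esub> ?a)"
        using cl by (simp only: Q.inv_mult_group Q.m_assoc Q.m_closed Q.inv_closed)
      finally have "?q (a \<otimes> b \<otimes> inv a \<otimes> inv b) =
        (?a \<otimes>\<^bsub>G Mod ?N\<^esub> ?b) \<otimes>\<^bsub>G Mod ?N\<^esub> inv\<^bsub>G Mod ?N\<^esub> (?b \<otimes>\<^bsub>G Mod ?N\<^esub> ?a)" .
      then show ?thesis
        using cl Q.inv_solve_right'[of "\<one>\<^bsub>G Mod ?N\<^esub>" "?a \<otimes>\<^bsub>G Mod ?N\<^esub> ?b" "?b \<otimes>\<^bsub>G Mod ?N\<^esub> ?a"]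
        by (simp only: Q.m_closed Q.one_closed Q.l_one)
    qed
    finally show ?thesis .
  qed
  have gen_comm: "?q x \<otimes>\<^bsub>G Mod ?N\<^esub> c = c \<otimes>\<^bsub>G Mod ?N\<^esub> ?q x"
    if c: "c \<in> carrier (G Mod ?N)"
      and S_comm: "\<And>s. s \<in> S \<Longrightarrow> ?q s \<otimes>\<^bsub>G Mod ?N\<^esub> c = c \<otimes>\<^bsub>G Mod ?N\<^esub> ?q s"
      and x: "x \<in> generate G S" for x c
    using x
  proof (induction rule: generate.induct)
    case one
    show ?case
      by (simp only: q.hom_one Q.l_one[OF c] Q.r_one[OF c])
  next
    case (incl h)
    then show ?case by (rule S_comm)
  next
    case (inv h)
    then have h: "h \<in> carrier G" using S by blast
    show ?case
      by (simp only: q.hom_inv[OF h] Q.inv_comm_commutes[OF q.hom_closed[OF h] c S_comm[OF inv]])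
  next
    case (eng x y)
    have xy: "x \<in> carrier G" "y \<in> carrier G"
      using eng.hyps generate_in_carrier[OF S] by blast+
    note cl = q.hom_closed[OF xy(1)] q.hom_closed[OF xy(2)]
    show ?case
      by (simp only: q.hom_mult[OF xy] Q.m_assoc[OF cl c] eng.IH(2)
          Q.m_assoc[OF cl(1) c cl(2), symmetric] eng.IH(1) Q.m_assoc[OF c cl])
  qed
  have "derived_set G (generate G S) \<subseteq> ?N"
  proof
    fix d assume "d \<in> derived_set G (generate G S)"
    then obtain a b where ab: "a \<in> generate G S" "b \<in> generate G S" "d = a \<otimes> b \<otimes> inv a \<otimes> inv b"
      by auto
    have abG: "a \<in> carrier G" "b \<in> carrier G"
      using ab generate_in_carrier[OF S] by auto
    have 1: "?q s \<otimes>\<^bsub>G Mod ?N\<^esub> ?q t = ?q t \<otimes>\<^bsub>G Mod ?N\<^esub> ?q s" if "s \<in> S" "t \<in> S" for s t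
    proof -
      have "s \<otimes> t \<otimes> inv s \<otimes> inv t \<in> ?N"
        using that by (intro generate.incl) auto
      then show ?thesis using comm_iff that S by blast
    qed
    have 2: "?q a \<otimes>\<^bsub>G Mod ?N\<^esub> ?q t = ?q t \<otimes>\<^bsub>G Mod ?N\<^esub> ?q a" if t: "t \<in> S" for t
      by (rule gen_comm[OF q.hom_closed 1[OF _ t] ab(1)]) (use t S in blast)
    have "?q b \<otimes>\<^bsub>G Mod ?N\<^esub> ?q a = ?q a \<otimes>\<^bsub>G Mod ?N\<^esub> ?q b"
      by (rule gen_comm[OF q.hom_closed[OF abG(1)] 2[symmetric] ab(2)])
    then show "d \<in> ?N"
      unfolding ab(3) using comm_iff[OF abG] by simp
  qed
  then show "derived G (generate G S) \<subseteq> ?N"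
    unfolding derived_def by (rule generate_subgroup_incl[OF _ N.subgroup_axioms])
next
  have "derived_set G S \<subseteq> derived_set G (generate G S)"
    using generate.incl[of _ S G] by blast
  then show "generate G (derived_set G S) \<subseteq> derived G (generate G S)"
    unfolding derived_def by (rule mono_generate)
qed

lemma (in group) derived_series_generate:
  "(derived G ^^ l) (carrier G) = generate G ((derived_set G ^^ l) (carrier G))"
proof -
  have *: "(derived_set G ^^ l) (carrier G) \<subseteq> carrier G \<and>
    (\<forall>s \<in> (derived_set G ^^ l) (carrier G). \<forall>g \<in> carrier G. g \<otimes> s \<otimes> inv g \<in> (derived_set G ^^ l) (carrier G))"
    for l
  proof (induction l)
    case (Suc l)
    let ?S = "(derived_set G ^^ l) (carrier G)"
    have "derived_set G ?S \<subseteq> carrier G"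
      using Suc by (intro derived_set_in_carrier) auto
    moreover have "g \<otimes> d \<otimes> inv g \<in> derived_set G ?S"
      if d: "d \<in> derived_set G ?S" and g: "g \<in> carrier G" for d g
    proof -
      obtain a b where ab: "a \<in> ?S" "b \<in> ?S" "d = a \<otimes> b \<otimes> inv a \<otimes> inv b"
        using d by auto
      have "g \<otimes> d \<otimes> inv g =
        (g \<otimes> a \<otimes> inv g) \<otimes> (g \<otimes> b \<otimes> inv g) \<otimes> inv (g \<otimes> a \<otimes> inv g) \<otimes> inv (g \<otimes> b \<otimes> inv g)"
        unfolding ab(3) using ab Suc g by (intro commutator_conj) auto
      moreover have "g \<otimes> a \<otimes> inv g \<in> ?S" "g \<otimes> b \<otimes> inv g \<in> ?S"
        using ab Suc g by auto
      ultimately show ?thesis by blast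
    qed
    ultimately show ?case by simp
  qed auto
  show ?thesis
  proof (induction l)
    case 0
    then show ?case
      using generate_incl[of "carrier G"] generate.incl[of _ "carrier G" G] by auto
  next
    case (Suc l)
    then show ?case
      using *[of l] derived_generate[of "(derived_set G ^^ l) (carrier G)"] by simp
  qed
qed

lemma satisfies_derived_word:
  assumes "group G"
  shows "satisfies_laws G {derived_word l 0} \<longleftrightarrow> derived_length_le G l"
proof -
  interpret group G by fact
  let ?S = "(derived_set G ^^ l) (carrier G)"
  have "satisfies_laws G {derived_word l 0} \<longleftrightarrow> ?S \<subseteq> {\<one>\<^bsub>G\<^esub>}"
    unfolding satisfies_laws_def derived_word_values[of l 0, symmetric] by blast
  also have "\<dots> \<longleftrightarrow> generate G ?S = {\<one>\<^bsub>G\<^esub>}"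
  proof
    assume "?S \<subseteq> {\<one>\<^bsub>G\<^esub>}"
    then have "generate G ?S \<subseteq> {\<one>\<^bsub>G\<^esub>}"
      by (intro generate_subgroup_incl triv_subgroup)
    then show "generate G ?S = {\<one>\<^bsub>G\<^esub>}"
      using generate.one[of G ?S] by auto
  qed (use generate.incl[of _ ?S G] in blast)
  finally show ?thesis
    by (simp add: derived_length_le_def derived_series_generate)
qed

lemma ex_defines_solvable_variety: "\<exists>V. defines_solvable_variety V l"
  using satisfies_derived_word unfolding defines_solvable_variety_def by blast

lemma satisfies_laws_transfer:
  assumes "\<And>H :: nat monoid. group H \<Longrightarrow> satisfies_laws H V \<Longrightarrow> satisfies_laws H W"
    and "group G" "satisfies_laws G V"
  shows "satisfies_laws G W"
  unfolding satisfies_laws_def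
proof (intro ballI)
  fix w and f :: "nat \<Rightarrow> 'a" assume w: "w \<in> W" and f: "f \<in> UNIV \<rightarrow> carrier G"
  interpret group G by fact
  define K where "K = subgroup_generated G (range f)"
  interpret K: group K
    unfolding K_def by simp
  have one_K: "\<one>\<^bsub>K\<^esub> = \<one>\<^bsub>G\<^esub>"
    by (simp add: K_def)
  have K_sub: "carrier K \<subseteq> carrier G"
    unfolding K_def by (rule carrier_subgroup_generated_subset)
  have K_eq: "word_val G g v = word_val K g v" if "g \<in> UNIV \<rightarrow> carrier K" for g and v :: "nat word"
  proof -
    have "(\<lambda>x. x) \<in> hom K G"
      using K_sub by (auto simp: K_def hom_def)
    from word_val_hom[OF K.is_group is_group this, of v g] that show ?thesis
      by (simp add: comp_def Pi_iff)
  qed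
  have fG: "range f \<subseteq> carrier G"
    using f by auto
  have gen: "carrier K = generate G (range f)"
    using fG by (simp add: K_def carrier_subgroup_generated Int_absorb1)
  have fK: "f \<in> UNIV \<rightarrow> carrier K"
    unfolding gen by (auto intro: generate.incl)
  have "g \<in> range (word_val G f)" if "g \<in> generate G (range f)" for g
    using that
  proof induction
    case one
    show ?case by (rule range_eqI[of _ _ "[]"]) simp
  next
    case (incl h)
    then obtain i where "h = f i" by auto
    then show ?case using f by (intro range_eqI[of _ _ "[(True, i)]"]) (simp add: Pi_iff)
  next
    case (inv h)
    then obtain i where "h = f i" by auto
    then show ?case using f by (intro range_eqI[of _ _ "[(False, i)]"]) (simp add: Pi_iff)
  next
    case (eng g h)
    then obtain u v where "g = word_val G f u" "h = word_val G f v" by auto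
    then show ?case using f by (intro range_eqI[of _ _ "u @ v"]) (simp add: Pi_iff word_val_append)
  qed
  then have "carrier K \<subseteq> range (word_val G f)"
    unfolding gen by blast
  then have "countable (carrier K)"
    by (rule countable_subset) (intro countable_image countableI_type)
  define e where "e = to_nat_on (carrier K)"
  have e: "inj_on e (carrier K)"
    unfolding e_def using \<open>countable (carrier K)\<close> by (rule inj_on_to_nat_on)
  define H where "H = image_group e K"
  have wm: "weak_group_morphism e {\<one>\<^bsub>K\<^esub>} K"
  proof (rule weak_group_morphism.intro)
    show "{\<one>\<^bsub>K\<^esub>} \<lhd> K" by (rule K.one_is_normal)
    show "weak_group_morphism_axioms e {\<one>\<^bsub>K\<^esub>} K"
    proof
      fix a b assume ab: "a \<in> carrier K" "b \<in> carrier K"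
      have "e a = e b \<longleftrightarrow> a = b"
        using e ab by (auto dest: inj_onD)
      also have "\<dots> \<longleftrightarrow> a \<otimes>\<^bsub>K\<^esub> inv\<^bsub>K\<^esub> b = \<one>\<^bsub>K\<^esub>"
        using ab K.inv_solve_right'[of "\<one>\<^bsub>K\<^esub>" a b] by simp
      finally show "e a = e b \<longleftrightarrow> a \<otimes>\<^bsub>K\<^esub> inv\<^bsub>K\<^esub> b \<in> {\<one>\<^bsub>K\<^esub>}" by simp
    qed
  qed
  have H: "group H" and hom: "e \<in> hom K H"
    unfolding H_def using K.image_group_is_group[OF wm] K.weak_group_morphism_is_hom[OF wm] by auto
  have eval: "e (word_val K g v) = word_val H (e \<circ> g) v"
    if "g \<in> UNIV \<rightarrow> carrier K" for g and v :: "nat word"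
    by (rule word_val_hom[OF K.is_group H hom]) (use that in blast)
  have one: "\<one>\<^bsub>H\<^esub> = e \<one>\<^bsub>K\<^esub>" and carr: "carrier H = e ` carrier K"
    unfolding H_def by (rule image_group_one, rule image_group_carrier)
  have "satisfies_laws H V"
    unfolding satisfies_laws_def
  proof (intro ballI)
    fix v and f' :: "nat \<Rightarrow> nat" assume v: "v \<in> V" and f': "f' \<in> UNIV \<rightarrow> carrier H"
    define g where "g = inv_into (carrier K) e \<circ> f'"
    have f'K: "f' i \<in> e ` carrier K" for i
      using f' unfolding carr by blast
    have g: "g \<in> UNIV \<rightarrow> carrier K"
      by (rule funcsetI) (simp only: g_def comp_apply inv_into_into[OF f'K])
    have "e \<circ> g = f'"
      by (rule ext) (simp only: g_def comp_apply f_inv_into_f[OF f'K])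
    moreover have "word_val K g v = \<one>\<^bsub>K\<^esub>"
    proof -
      have "g \<in> UNIV \<rightarrow> carrier G" using g K_sub by auto
      then show ?thesis
        using assms(3) v K_eq[OF g, of v] one_K unfolding satisfies_laws_def by metis
    qed
    ultimately show "word_val H f' v = \<one>\<^bsub>H\<^esub>"
      using eval[OF g, of v] one by simp
  qed
  then have "satisfies_laws H W"
    using assms(1) H by blast
  moreover have "e \<circ> f \<in> UNIV \<rightarrow> carrier H"
    using fK unfolding carr by auto
  ultimately have "e (word_val K f w) = e \<one>\<^bsub>K\<^esub>"
    using w eval[OF fK, of w] one by (simp add: satisfies_laws_def)
  moreover have "word_val K f w \<in> carrier K"
    using fK by (intro K.word_val_closed) auto
  ultimately have "word_val K f w = \<one>\<^bsub>K\<^esub>"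
    using e by (meson K.one_closed inj_onD)
  then show "word_val G f w = \<one>\<^bsub>G\<^esub>"
    using K_eq[OF fK, of w] one_K by simp
qed

lemma defines_solvable_variety_iff:
  assumes "defines_solvable_variety V l" "group G"
  shows "satisfies_laws G V \<longleftrightarrow> derived_length_le G l"
proof -
  have "satisfies_laws H V \<longleftrightarrow> satisfies_laws H {derived_word l 0}" if "group H" for H :: "nat monoid"
    using assms(1) that satisfies_derived_word[OF that, of l]
    by (simp add: defines_solvable_variety_def)
  then have "satisfies_laws G V \<longleftrightarrow> satisfies_laws G {derived_word l 0}"
    using satisfies_laws_transfer[of V "{derived_word l 0}" G]
      satisfies_laws_transfer[of "{derived_word l 0}" V G] assms(2) by blast
  then show ?thesis
    by (simp add: satisfies_derived_word[OF assms(2)])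
qed

end

theory Submission
  imports Defs
begin

text \<open>Let \<open>P\<^sub>i = \<delta>\<^sup>i(F)\<close>, \<open>N\<^sub>0 = R\<close> and \<open>N\<^sub>i\<^sub>+\<^sub>1 = [N\<^sub>i, P\<^sub>i]\<close>. Comparing the verbal subgroup of the fibre square
  \<open>F \<times>\<^bsub>F/R\<^esub> F\<close> for an arbitrary set of words of the variety with its derived series gives
  \<open>[R V\<^sup>* F] = N\<^sub>l\<close>, so that the Baer invariant is \<open>P\<^sub>l / N\<^sub>l\<close>. Each \<open>P\<^sub>i\<close> is a subgroup of a free group,
  so the abelian quotient \<open>P\<^sub>i \<rightarrow> P\<^sub>i / N\<^sub>i = \<Oplus>\<^sub>j \<int>/a\<^sub>j\<close> lifts to an integral Heisenberg group of class two;
  with \<open>a\<^sub>j\<close> dividing \<open>a\<^sub>i\<close> for \<open>i < j\<close>, the central coordinates of the lift identify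
  \<open>P\<^sub>i\<^sub>+\<^sub>1 / N\<^sub>i\<^sub>+\<^sub>1\<close> with \<open>\<Oplus>\<^sub>i\<^sub><\<^sub>j \<int>/a\<^sub>j\<close>, the exterior square. Ordering the pairs by their second entry
  again gives a divisibility chain, in which the first \<open>\<chi>\<^sub>2(d)\<close> entries come from the first \<open>d\<close>.\<close>

section \<open>Lifting homomorphisms from subgroups of free groups\<close>

text \<open>Modulo \<open>[N,P]\<close> the commutator is bilinear on \<open>P\<close>, so it is
  easy to see that commutators of lifts of the generators of \<open>P / N\<close> generate
  \<open>[P,P] / [N,P]\<close>. The obstacle is their independence. Instead of normal forms for
  basic commutators, a homomorphism from \<open>P\<close> to a Heisenberg group detects them,
  because the central part of the image of \<open>[p,q]\<close> consists of the minors
  \<open>A p i * A q j - A q i * A p j\<close>. Of the freeness of \<open>P\<close> only this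
  lifting property is used. The other obstacle is that the set of words is arbitrary: the generators
  of the Baer commutator subgroup depend on it, and only the class of groups obeying the laws is
  known. Hence they have to be read off from the verbal subgroup of one suitable group. In the fibre
  square, a change of variables by elements of \<open>R\<close> becomes a single assignment of
  pairs.\<close>

lemma (in group) inv_cancel_left:
  assumes "x \<in> carrier G" "y \<in> carrier G"
  shows "inv x \<otimes> (x \<otimes> y) = y" "x \<otimes> (inv x \<otimes> y) = y"
  using assms by (simp_all add: m_assoc[symmetric])

text \<open>This supplies the uniqueness half of the universal property, of which
  \<open>free_basis_universal\<close> gives existence.\<close>

lemma free_basis_hom_eq_id:
  assumes F: "group F" "free_basis F S" and h: "h \<in> hom F F" "\<And>s. s \<in> S \<Longrightarrow> h s = s"
    and x: "x \<in> carrier F"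
  shows "h x = x"
proof -
  have "x \<in> word_val F (\<lambda>x. x) ` {w. reduced w \<and> snd ` set w \<subseteq> S}" and S: "S \<subseteq> carrier F"
    using F x by (auto simp: free_basis_def bij_betw_def)
  then obtain w where w: "snd ` set w \<subseteq> S" and xw: "x = word_val F (\<lambda>x. x) w"
    by blast
  have "h x = word_val F (h \<circ> (\<lambda>x. x)) w"
    unfolding xw using w S by (intro word_val_hom F h) auto
  also have "\<dots> = x"
    unfolding xw using w h(2) by (intro word_val_cong) auto
  finally show ?thesis .
qed

text \<open>This replaces the Nielsen--Schreier theorem. The group \<open>W\<close> is a subgroup of the wreath product
  of \<open>E\<close> with the action of \<open>F\<close> on the cosets of \<open>H\<close>; a section of \<open>W \<rightarrow> F\<close>, which exists since \<open>F\<close>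
  is free, is evaluated at the trivial coset.\<close>

lemma free_subgroup_lift:
  assumes F: "group F" "free_basis F S" and H: "subgroup H F" and E: "group E"
    and \<rho>: "subgroup \<rho> (F \<times>\<times> E)" and total: "\<And>h. h \<in> H \<Longrightarrow> \<exists>e. (h, e) \<in> \<rho>"
  shows "\<exists>g \<in> hom (F\<lparr>carrier := H\<rparr>) E. \<forall>h\<in>H. (h, g h) \<in> \<rho>"
proof -
  interpret F: group F by fact
  interpret E: group E by fact
  interpret H: subgroup H F by fact
  note FE = F.is_group E.is_group
  have \<rho>_carr: "a \<in> carrier F" "b \<in> carrier E" if "(a, b) \<in> \<rho>" for a b
    using subgroup.subset[OF \<rho>] that by auto
  have \<rho>_mult: "(a \<otimes>\<^bsub>F\<^esub> a', b \<otimes>\<^bsub>E\<^esub> b') \<in> \<rho>" if "(a, b) \<in> \<rho>" "(a', b') \<in> \<rho>" for a b a' b'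
    using subgroup.m_closed[OF \<rho> that] by simp
  have \<rho>_inv: "(inv\<^bsub>F\<^esub> a, inv\<^bsub>E\<^esub> b) \<in> \<rho>" if "(a, b) \<in> \<rho>" for a b
    using subgroup.m_inv_closed[OF \<rho> that] inv_DirProd[OF FE \<rho>_carr[OF that]] by simp
  have \<rho>_one: "(\<one>\<^bsub>F\<^esub>, \<one>\<^bsub>E\<^esub>) \<in> \<rho>"
    using subgroup.one_closed[OF \<rho>] by simp
  \<comment> \<open>\<open>t\<close> picks a representative of each right coset of \<open>H\<close>;
    choosing 1 for \<open>H\<close> itself is what makes \<open>c\<close> the identity on
    \<open>H\<close> in \<open>c_unit\<close>.\<close>
  define t where "t x = (if x \<in> H then \<one>\<^bsub>F\<^esub> else SOME y. y \<in> H #>\<^bsub>F\<^esub> x)" for x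
  have t_in: "t x \<in> H #>\<^bsub>F\<^esub> x" if x: "x \<in> carrier F" for x
  proof (cases "x \<in> H")
    case True
    then show ?thesis using F.coset_join2[OF x H True] by (simp add: t_def)
  next
    case False
    then show ?thesis using F.rcos_self[OF x H] by (auto simp: t_def intro: someI)
  qed
  have tE: "\<exists>h\<in>H. t x = h \<otimes>\<^bsub>F\<^esub> x" if "x \<in> carrier F" for x
    using t_in[OF that] by (auto simp: r_coset_def)
  have t_carr [simp]: "t x \<in> carrier F" if "x \<in> carrier F" for x
    using tE[OF that] that by auto
  have t_const: "t (h \<otimes>\<^bsub>F\<^esub> x) = t x" if "h \<in> H" "x \<in> carrier F" for h x
  proof -
    have "H #>\<^bsub>F\<^esub> (h \<otimes>\<^bsub>F\<^esub> x) = H #>\<^bsub>F\<^esub> x"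
      using that F.coset_mult_assoc[of H h x] F.coset_join2[OF _ H] H.subset by simp
    moreover have "h \<otimes>\<^bsub>F\<^esub> x \<in> H \<longleftrightarrow> x \<in> H"
    proof
      assume "h \<otimes>\<^bsub>F\<^esub> x \<in> H"
      then have "inv\<^bsub>F\<^esub> h \<otimes>\<^bsub>F\<^esub> (h \<otimes>\<^bsub>F\<^esub> x) \<in> H" using that by blast
      then show "x \<in> H" using that F.inv_cancel_left by simp
    qed (use that in blast)
    ultimately show ?thesis by (simp add: t_def)
  qed
  \<comment> \<open>The Schreier cocycle: right multiplication by \<open>f\<close> leads from the
    coset of \<open>x\<close> to that of the product, and \<open>c x f\<close> is the error in
    \<open>H\<close> between the chosen representatives.\<close>
  define c where "c x f = t x \<otimes>\<^bsub>F\<^esub> f \<otimes>\<^bsub>F\<^esub> inv\<^bsub>F\<^esub> t (x \<otimes>\<^bsub>F\<^esub> f)" for x f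
  have c_H: "c x f \<in> H" if x: "x \<in> carrier F" and f: "f \<in> carrier F" for x f
  proof -
    obtain h k where hk: "h \<in> H" "t x = h \<otimes>\<^bsub>F\<^esub> x" "k \<in> H" "t (x \<otimes>\<^bsub>F\<^esub> f) = k \<otimes>\<^bsub>F\<^esub> (x \<otimes>\<^bsub>F\<^esub> f)"
      using tE[OF x] tE[of "x \<otimes>\<^bsub>F\<^esub> f"] x f by blast
    then have "h \<in> carrier F" "k \<in> carrier F" by auto
    then have "c x f = h \<otimes>\<^bsub>F\<^esub> inv\<^bsub>F\<^esub> k"
      unfolding c_def hk using x f by (simp add: F.m_assoc F.inv_mult_group F.inv_cancel_left)
    then show ?thesis using hk by simp
  qed
  have c_mult: "c x (f \<otimes>\<^bsub>F\<^esub> g) = c x f \<otimes>\<^bsub>F\<^esub> c (x \<otimes>\<^bsub>F\<^esub> f) g"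
    if "x \<in> carrier F" "f \<in> carrier F" "g \<in> carrier F" for x f g
    using that by (simp add: c_def F.m_assoc F.inv_cancel_left)
  have c_const: "c (h \<otimes>\<^bsub>F\<^esub> x) f = c x f" if "h \<in> H" "x \<in> carrier F" "f \<in> carrier F" for h x f
    using that t_const by (simp add: c_def F.m_assoc)
  have c_one: "c x \<one>\<^bsub>F\<^esub> = \<one>\<^bsub>F\<^esub>" if "x \<in> carrier F" for x
    using that by (simp add: c_def)
  have c_inv: "c x (inv\<^bsub>F\<^esub> f) = inv\<^bsub>F\<^esub> c (x \<otimes>\<^bsub>F\<^esub> inv\<^bsub>F\<^esub> f) f" if "x \<in> carrier F" "f \<in> carrier F" for x f
    using that by (simp add: c_def F.m_assoc F.inv_mult_group)
  have c_unit: "c \<one>\<^bsub>F\<^esub> h = h" if "h \<in> H" for h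
    using that by (simp add: c_def t_def)
  \<comment> \<open>An element is some \<open>f\<close> together with, for every coset of
    \<open>H\<close>, a partner in \<open>E\<close> of \<open>c x f\<close> under
    \<open>\<rho>\<close>. Functions on cosets are encoded as functions invariant under left
    multiplication by \<open>H\<close>.\<close>
  define carr where "carr = {(\<alpha>, f). \<alpha> \<in> carrier F \<rightarrow>\<^sub>E carrier E \<and> f \<in> carrier F \<and>
      (\<forall>x\<in>carrier F. (c x f, \<alpha> x) \<in> \<rho>) \<and> (\<forall>h\<in>H. \<forall>x\<in>carrier F. \<alpha> (h \<otimes>\<^bsub>F\<^esub> x) = \<alpha> x)}"
  define W where "W = \<lparr>carrier = carr,
      monoid.mult = (\<lambda>a b. (\<lambda>x\<in>carrier F. fst a x \<otimes>\<^bsub>E\<^esub> fst b (x \<otimes>\<^bsub>F\<^esub> snd a), snd a \<otimes>\<^bsub>F\<^esub> snd b)),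
      one = (\<lambda>x\<in>carrier F. \<one>\<^bsub>E\<^esub>, \<one>\<^bsub>F\<^esub>)\<rparr>"
  have carrI: "(\<lambda>x\<in>carrier F. \<alpha> x, f) \<in> carr"
    if "f \<in> carrier F" "\<And>x. x \<in> carrier F \<Longrightarrow> (c x f, \<alpha> x) \<in> \<rho>"
      "\<And>h x. h \<in> H \<Longrightarrow> x \<in> carrier F \<Longrightarrow> \<alpha> (h \<otimes>\<^bsub>F\<^esub> x) = \<alpha> x" for \<alpha> f
    using that \<rho>_carr(2)[OF that(2)] by (auto simp: carr_def)
  have carrD: "f \<in> carrier F" "\<alpha> \<in> extensional (carrier F)" "\<And>x. x \<in> carrier F \<Longrightarrow> \<alpha> x \<in> carrier E"
      "\<And>x. x \<in> carrier F \<Longrightarrow> (c x f, \<alpha> x) \<in> \<rho>"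
      "\<And>h x. h \<in> H \<Longrightarrow> x \<in> carrier F \<Longrightarrow> \<alpha> (h \<otimes>\<^bsub>F\<^esub> x) = \<alpha> x"
    if "(\<alpha>, f) \<in> carr" for \<alpha> f
    using that by (auto simp: carr_def PiE_iff)
  have "group W"
  proof (rule groupI)
    fix a b assume ab: "a \<in> carrier W" "b \<in> carrier W"
    obtain \<alpha> f \<beta> g where [simp]: "a = (\<alpha>, f)" "b = (\<beta>, g)" by (cases a, cases b)
    have A: "(\<alpha>, f) \<in> carr" and B: "(\<beta>, g) \<in> carr" using ab by (auto simp: W_def)
    have "(\<lambda>x\<in>carrier F. \<alpha> x \<otimes>\<^bsub>E\<^esub> \<beta> (x \<otimes>\<^bsub>F\<^esub> f), f \<otimes>\<^bsub>F\<^esub> g) \<in> carr"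
    proof (rule carrI)
      show "(c x (f \<otimes>\<^bsub>F\<^esub> g), \<alpha> x \<otimes>\<^bsub>E\<^esub> \<beta> (x \<otimes>\<^bsub>F\<^esub> f)) \<in> \<rho>" if "x \<in> carrier F" for x
        using that carrD(1,4)[OF A] carrD(1,4)[OF B] by (simp add: c_mult \<rho>_mult)
    qed (use carrD[OF A] carrD[OF B] in \<open>simp_all add: F.m_assoc\<close>)
    then show "a \<otimes>\<^bsub>W\<^esub> b \<in> carrier W" by (simp add: W_def)
  next
    have "(\<lambda>x\<in>carrier F. \<one>\<^bsub>E\<^esub>, \<one>\<^bsub>F\<^esub>) \<in> carr"
      by (rule carrI) (simp_all add: c_one \<rho>_one)
    then show "\<one>\<^bsub>W\<^esub> \<in> carrier W" by (simp add: W_def)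
  next
    fix a b d assume abd: "a \<in> carrier W" "b \<in> carrier W" "d \<in> carrier W"
    obtain \<alpha> f \<beta> g \<gamma> h where [simp]: "a = (\<alpha>, f)" "b = (\<beta>, g)" "d = (\<gamma>, h)"
      by (cases a, cases b, cases d)
    have "(\<alpha>, f) \<in> carr" "(\<beta>, g) \<in> carr" "(\<gamma>, h) \<in> carr" using abd by (auto simp: W_def)
    note D = carrD[OF this(1)] carrD[OF this(2)] carrD[OF this(3)]
    show "a \<otimes>\<^bsub>W\<^esub> b \<otimes>\<^bsub>W\<^esub> d = a \<otimes>\<^bsub>W\<^esub> (b \<otimes>\<^bsub>W\<^esub> d)"
      using D by (auto simp: W_def F.m_assoc E.m_assoc restrict_def fun_eq_iff)
  next
    fix a assume a: "a \<in> carrier W"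
    obtain \<alpha> f where [simp]: "a = (\<alpha>, f)" by (cases a)
    have A: "(\<alpha>, f) \<in> carr" using a by (auto simp: W_def)
    show "\<one>\<^bsub>W\<^esub> \<otimes>\<^bsub>W\<^esub> a = a"
      using carrD[OF A] by (auto simp: W_def fun_eq_iff extensional_def)
    let ?b = "(\<lambda>x\<in>carrier F. inv\<^bsub>E\<^esub> \<alpha> (x \<otimes>\<^bsub>F\<^esub> inv\<^bsub>F\<^esub> f), inv\<^bsub>F\<^esub> f)"
    have "?b \<in> carr"
    proof (rule carrI)
      show "(c x (inv\<^bsub>F\<^esub> f), inv\<^bsub>E\<^esub> \<alpha> (x \<otimes>\<^bsub>F\<^esub> inv\<^bsub>F\<^esub> f)) \<in> \<rho>" if "x \<in> carrier F" for x
        using that carrD(1,4)[OF A] by (simp add: c_inv \<rho>_inv)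
    qed (use carrD[OF A] in \<open>simp_all add: F.m_assoc\<close>)
    then have "?b \<in> carrier W" by (simp add: W_def)
    moreover have "?b \<otimes>\<^bsub>W\<^esub> a = \<one>\<^bsub>W\<^esub>"
      using carrD[OF A] by (auto simp: W_def fun_eq_iff)
    ultimately show "\<exists>y\<in>carrier W. y \<otimes>\<^bsub>W\<^esub> a = \<one>\<^bsub>W\<^esub>"
      by blast
  qed
  obtain e where e: "\<And>h. h \<in> H \<Longrightarrow> (h, e h) \<in> \<rho>"
    using total by metis
  \<comment> \<open>A set-theoretic section of the projection to \<open>F\<close>. Only its values
    on \<open>S\<close> are kept; freeness extends them to the homomorphism
    \<open>h\<close>.\<close>
  define s where "s f = (\<lambda>x\<in>carrier F. e (c x f), f)" for f
  have s: "s f \<in> carrier W" if "f \<in> carrier F" for f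
    using that by (auto simp: W_def s_def c_const intro!: carrI e c_H)
  have S: "S \<subseteq> carrier F"
    using F by (simp add: free_basis_def)
  then have "s \<in> S \<rightarrow> carrier W"
    using s by blast
  then obtain h where h: "h \<in> hom F W" and hS: "\<forall>x\<in>S. h x = s x"
    using free_basis_universal[OF F \<open>group W\<close>] by blast
  have hW: "(fst (h x), snd (h x)) \<in> carr" if "x \<in> carrier F" for x
    using hom_in_carrier[OF h that] by (simp add: W_def)
  have h_mult: "h (x \<otimes>\<^bsub>F\<^esub> y) = h x \<otimes>\<^bsub>W\<^esub> h y" if "x \<in> carrier F" "y \<in> carrier F" for x y
    using h that by (rule hom_mult)
  have "snd (h (x \<otimes>\<^bsub>F\<^esub> y)) = snd (h x) \<otimes>\<^bsub>F\<^esub> snd (h y)" if "x \<in> carrier F" "y \<in> carrier F" for x y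
    unfolding h_mult[OF that] by (simp add: W_def)
  \<comment> \<open>Projecting \<open>h\<close> back to \<open>F\<close> gives an endomorphism
    fixing \<open>S\<close>, hence the identity, so \<open>h\<close> is a section too.\<close>
  then have "(\<lambda>x. snd (h x)) \<in> hom F F"
    using carrD(1)[OF hW] by (intro homI)
  moreover have "snd (h x) = x" if "x \<in> S" for x
    using bspec[OF hS that] by (simp add: s_def)
  ultimately have snd_h: "snd (h x) = x" if "x \<in> carrier F" for x
    using that by (rule free_basis_hom_eq_id[OF F])
  let ?g = "\<lambda>x. fst (h x) \<one>\<^bsub>F\<^esub>"
  have g_mult: "?g (x \<otimes>\<^bsub>F\<^esub> y) = ?g x \<otimes>\<^bsub>E\<^esub> ?g y" if "x \<in> H" "y \<in> H" for x y
  proof -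
    have xy: "x \<in> carrier F" "y \<in> carrier F" using that by auto
    have "?g (x \<otimes>\<^bsub>F\<^esub> y) = ?g x \<otimes>\<^bsub>E\<^esub> fst (h y) x"
      unfolding h_mult[OF xy] using xy snd_h[OF xy(1)] by (simp add: W_def)
    \<comment> \<open>As \<open>x\<close> lies in \<open>H\<close>, the shift by \<open>x\<close>
      stays in the trivial coset, on which the invariant function is constant.\<close>
    also have "fst (h y) x = ?g y"
      using carrD(5)[OF hW[OF xy(2)] that(1) F.one_closed] xy by simp
    finally show ?thesis .
  qed
  have "?g \<in> hom (F\<lparr>carrier := H\<rparr>) E"
  proof (rule homI)
    show "?g x \<in> carrier E" if "x \<in> carrier (F\<lparr>carrier := H\<rparr>)" for x
      using that carrD(3)[OF hW] by simp
  qed (simp add: g_mult)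
  moreover have "(x, ?g x) \<in> \<rho>" if "x \<in> H" for x
    using carrD(4)[OF hW, of x "\<one>\<^bsub>F\<^esub>"] that by (simp add: snd_h c_unit)
  ultimately show ?thesis
    by (intro bexI[of _ ?g] ballI)
qed

section \<open>Commutator subgroups\<close>

definition commutator :: "('a, 'b) monoid_scheme \<Rightarrow> 'a \<Rightarrow> 'a \<Rightarrow> 'a" where
  "commutator G x y = x \<otimes>\<^bsub>G\<^esub> y \<otimes>\<^bsub>G\<^esub> inv\<^bsub>G\<^esub> x \<otimes>\<^bsub>G\<^esub> inv\<^bsub>G\<^esub> y"

definition commutator_subgroup :: "('a, 'b) monoid_scheme \<Rightarrow> 'a set \<Rightarrow> 'a set \<Rightarrow> 'a set" where
  "commutator_subgroup G A B = generate G {commutator G x y | x y. x \<in> A \<and> y \<in> B}"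

context group
begin

lemma commutator_closed [simp]:
  "x \<in> carrier G \<Longrightarrow> y \<in> carrier G \<Longrightarrow> commutator G x y \<in> carrier G"
  by (simp add: commutator_def)

lemma inv_commutator:
  "x \<in> carrier G \<Longrightarrow> y \<in> carrier G \<Longrightarrow> inv (commutator G x y) = commutator G y x"
  by (simp add: commutator_def inv_mult_group m_assoc)

lemma commutator_mult_swap:
  "x \<in> carrier G \<Longrightarrow> y \<in> carrier G \<Longrightarrow> commutator G x y \<otimes> (y \<otimes> x) = x \<otimes> y"
  by (simp add: commutator_def m_assoc inv_cancel_left)

lemma conj_eq_commutator_mult:
  "x \<in> carrier G \<Longrightarrow> y \<in> carrier G \<Longrightarrow> x \<otimes> y \<otimes> inv x = commutator G x y \<otimes> y"
  by (simp add: commutator_def m_assoc)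

lemma commutator_one: "x \<in> carrier G \<Longrightarrow> commutator G x \<one> = \<one>"
  by (simp add: commutator_def)

lemma commutator_self: "x \<in> carrier G \<Longrightarrow> commutator G x x = \<one>"
  by (simp add: commutator_def m_assoc)

text \<open>Conjugation is written as a correction factor
  \<open>commutator G y (commutator G x z)\<close>, which can be discarded modulo
  \<open>[N,P]\<close> once \<open>commutator G x z\<close> lies in \<open>N\<close>.\<close>

lemma commutator_mult_right:
  assumes "x \<in> carrier G" "y \<in> carrier G" "z \<in> carrier G"
  shows "commutator G x (y \<otimes> z) =
    commutator G x y \<otimes> (commutator G y (commutator G x z) \<otimes> commutator G x z)"
  using assms by (simp add: commutator_def inv_mult_group m_assoc inv_cancel_left)

lemma commutator_subgroup_is_subgroup:
  "A \<subseteq> carrier G \<Longrightarrow> B \<subseteq> carrier G \<Longrightarrow> subgroup (commutator_subgroup G A B) G"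
  unfolding commutator_subgroup_def by (intro generate_is_subgroup) (auto simp: subset_eq)

lemma commutator_in_commutator_subgroup:
  "x \<in> A \<Longrightarrow> y \<in> B \<Longrightarrow> commutator G x y \<in> commutator_subgroup G A B"
  unfolding commutator_subgroup_def by (intro generate.incl) auto

lemma commutator_in_commutator_subgroup':
  assumes "A \<subseteq> carrier G" "B \<subseteq> carrier G" "x \<in> A" "y \<in> B"
  shows "commutator G y x \<in> commutator_subgroup G A B"
proof -
  have "inv (commutator G x y) \<in> commutator_subgroup G A B"
    using assms by (intro subgroup.m_inv_closed[OF commutator_subgroup_is_subgroup]
        commutator_in_commutator_subgroup)
  moreover have "x \<in> carrier G" "y \<in> carrier G" using assms by auto
  ultimately show ?thesis by (simp add: inv_commutator)
qed

lemma commutator_subgroup_normal: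
  assumes "A \<lhd> G" "B \<lhd> G"
  shows "commutator_subgroup G A B \<lhd> G"
  unfolding commutator_subgroup_def
proof (rule normal_generateI)
  interpret A: normal A G by fact
  interpret B: normal B G by fact
  show "{commutator G x y |x y. x \<in> A \<and> y \<in> B} \<subseteq> carrier G" by auto
  fix c g assume "c \<in> {commutator G x y |x y. x \<in> A \<and> y \<in> B}" and g: "g \<in> carrier G"
  then obtain x y where xy: "x \<in> A" "y \<in> B" "c = commutator G x y" by blast
  have "g \<otimes> c \<otimes> inv g = commutator G (g \<otimes> x \<otimes> inv g) (g \<otimes> y \<otimes> inv g)"
    unfolding xy(3) commutator_def using xy(1,2) g by (intro commutator_conj) auto
  then show "g \<otimes> c \<otimes> inv g \<in> {commutator G x y |x y. x \<in> A \<and> y \<in> B}"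
    using A.inv_op_closed2[OF g xy(1)] B.inv_op_closed2[OF g xy(2)] by blast
qed

lemma derived_eq_commutator_subgroup: "derived G H = commutator_subgroup G H H"
proof -
  have "derived_set G H = {commutator G x y |x y. x \<in> H \<and> y \<in> H}"
    unfolding commutator_def by blast
  then show ?thesis
    by (simp only: derived_def commutator_subgroup_def)
qed

lemma commutator_subgroup_mono:
  "A \<subseteq> A' \<Longrightarrow> commutator_subgroup G A B \<subseteq> commutator_subgroup G A' B"
  unfolding commutator_subgroup_def by (intro mono_generate) auto

lemma commutator_subgroup_subset:
  assumes "subgroup T G" "\<And>x y. x \<in> A \<Longrightarrow> y \<in> B \<Longrightarrow> commutator G x y \<in> T"
  shows "commutator_subgroup G A B \<subseteq> T"
  unfolding commutator_subgroup_def using assms by (intro generate_subgroup_incl) auto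

lemma generate_insert_decomp:
  assumes T: "subgroup T G" and x: "x \<in> carrier G"
    and norm: "\<And>k t. t \<in> T \<Longrightarrow> x [^] (k::int) \<otimes> t \<otimes> inv (x [^] k) \<in> T"
    and z: "z \<in> generate G (insert x T)"
  shows "\<exists>k::int. \<exists>t\<in>T. z = x [^] k \<otimes> t"
  using z
proof induction
  case one
  show ?case
    using subgroup.one_closed[OF T] by (intro exI[of _ 0] bexI[of _ \<one>]) auto
next
  case (incl h)
  then show ?case
  proof
    assume "h = x"
    then show ?thesis
      using subgroup.one_closed[OF T] x by (intro exI[of _ 1] bexI[of _ \<one>]) auto
  next
    assume "h \<in> T"
    then show ?thesis
      using subgroup.mem_carrier[OF T] by (intro exI[of _ 0] bexI[of _ h]) auto
  qed
next
  case (inv h)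
  then show ?case
  proof
    assume "h = x"
    then show ?thesis
      using subgroup.one_closed[OF T] x by (intro exI[of _ "-1"] bexI[of _ \<one>]) (auto simp: int_pow_neg)
  next
    assume "h \<in> T"
    then show ?thesis
      using subgroup.mem_carrier[OF T] subgroup.m_inv_closed[OF T]
      by (intro exI[of _ 0] bexI[of _ "inv h"]) auto
  qed
next
  case (eng y z)
  then obtain k l :: int and s t where *: "s \<in> T" "y = x [^] k \<otimes> s" "t \<in> T" "z = x [^] l \<otimes> t"
    by blast
  note carr = subgroup.mem_carrier[OF T]
  \<comment> \<open>Moving \<open>x [^] l\<close> to the left past \<open>s\<close> conjugates
    \<open>s\<close> by \<open>x [^] (- l)\<close>.\<close>
  let ?s = "x [^] (- l) \<otimes> s \<otimes> inv (x [^] (- l))"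
  have "y \<otimes> z = x [^] (k + l) \<otimes> (?s \<otimes> t)"
    using * x carr by (simp add: int_pow_mult m_assoc int_pow_neg inv_cancel_left)
  moreover have "?s \<otimes> t \<in> T"
    using subgroup.m_closed[OF T norm[OF *(1)] *(3)] .
  ultimately show ?case by blast
qed

text \<open>The relations saying that g s has order a s modulo C are all the relations between the g s,
  since the coordinates V detect them.\<close>

lemma generate_coords_kernel:
  fixes V :: "'a \<Rightarrow> 's \<Rightarrow> int" and a :: "'s \<Rightarrow> nat"
  assumes D: "subgroup D G" and C: "subgroup C G" "C \<subseteq> D"
    and comm: "\<And>x y. x \<in> D \<Longrightarrow> y \<in> D \<Longrightarrow> commutator G x y \<in> C"
    and hom: "\<And>s. (\<lambda>x. V x s) \<in> hom (G\<lparr>carrier := D\<rparr>) integer_group"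
    and VC: "\<And>x s. x \<in> C \<Longrightarrow> s \<in> S \<Longrightarrow> int (a s) dvd V x s"
    and g: "\<And>s. s \<in> S \<Longrightarrow> g s \<in> D" "\<And>s. s \<in> S \<Longrightarrow> g s [^] a s \<in> C"
      "\<And>s r. s \<in> S \<Longrightarrow> r \<in> S \<Longrightarrow> int (a r) dvd V (g s) r - (if r = s then 1 else 0)"
    and S: "finite S"
    and z: "z \<in> generate G (C \<union> g ` S)" "\<And>s. s \<in> S \<Longrightarrow> int (a s) dvd V z s"
  shows "z \<in> C"
  using S VC g z
proof (induction S arbitrary: z rule: finite_induct)
  case empty
  then show ?case
    using generate_subgroup_incl[OF _ C(1), of C] by auto
next
  case (insert s S)
  have DG: "D \<subseteq> carrier G" using D by (rule subgroup.subset)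
  let ?GD = "G\<lparr>carrier := D\<rparr>"
  have grD: "group ?GD" using D by (rule subgroup_imp_group)
  define T where "T = generate G (C \<union> g ` S)"
  have gensD: "C \<union> g ` S \<subseteq> D" using C insert.prems(2) by auto
  have T: "subgroup T G" unfolding T_def using gensD DG by (intro generate_is_subgroup) auto
  have TD: "T \<subseteq> D" unfolding T_def by (rule generate_subgroup_incl[OF gensD D])
  have CT: "C \<subseteq> T" unfolding T_def by (auto intro: generate.incl)
  have gs: "g s \<in> D" "g s \<in> carrier G" using insert.prems(2) DG by auto
  have pow_D: "g s [^] k \<in> D" for k :: int
    using D gs(1) by (rule subgroup_int_pow_closed)
  have V_mult: "V (x \<otimes> y) r = V x r + V y r" if "x \<in> D" "y \<in> D" for x y r
    using hom_mult[OF hom, of x y r] that by simp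
  have V_pow: "V (g s [^] k) r = k * V (g s) r" for k :: int and r
    using hom_int_pow[OF hom _ grD group_integer_group, of "g s" k r] gs
      int_pow_consistent[OF D gs(1), of k] by simp
  have V_one: "V \<one> r = 0" for r
    using hom_one[OF hom grD group_integer_group, of r] by simp
  have V_inv: "V (inv x) r = - V x r" if "x \<in> D" for x r
    using V_mult[of x "inv x" r] V_one that subgroup.m_inv_closed[OF D that] DG by auto
  have "z \<in> generate G (insert (g s) T)"
  proof -
    have "C \<union> g ` insert s S \<subseteq> insert (g s) T"
      unfolding T_def by (auto intro: generate.incl)
    then show ?thesis using insert.prems(5) mono_generate by blast
  qed
  moreover have "g s [^] k \<otimes> t \<otimes> inv (g s [^] k) \<in> T" if "t \<in> T" for k :: int and t
  proof -
    have t: "t \<in> D" using that TD by auto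
    \<comment> \<open>Conjugation changes \<open>t\<close> only by a commutator of elements of
      \<open>D\<close>, which lies in \<open>C\<close> and hence in \<open>T\<close>.\<close>
    have "commutator G (g s [^] k) t \<otimes> t \<in> T"
      using comm[OF pow_D t] CT that by (intro subgroup.m_closed[OF T]) auto
    then show ?thesis
      using conj_eq_commutator_mult[of "g s [^] k" t] pow_D[of k] t DG by (simp add: subsetD)
  qed
  ultimately obtain k :: int and t where t: "t \<in> T" and z: "z = g s [^] k \<otimes> t"
    using generate_insert_decomp[OF T gs(2)] by blast
  have Vz: "V z r = k * V (g s) r + V t r" for r
    using t TD pow_D by (simp add: z V_mult V_pow subsetD)
  have gens_s: "int (a s) dvd V h s" if "h \<in> C \<union> g ` S" for h
    using that
  proof
    assume "h \<in> g ` S"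
    then obtain r where r: "r \<in> S" "h = g r" by blast
    then have "s \<noteq> r" using insert.hyps by blast
    then show ?thesis using insert.prems(4)[of r s] r by simp
  qed (use insert.prems(1) in blast)
  have "int (a s) dvd V x s" if "x \<in> T" for x
    using that unfolding T_def
  proof induction
    case one
    then show ?case by (simp add: V_one)
  next
    case (incl h)
    then show ?case by (rule gens_s)
  next
    case (inv h)
    then show ?case using gens_s[of h] V_inv[of h s] gensD by auto
  next
    case (eng x y)
    then show ?case using TD by (auto simp: V_mult T_def subset_eq)
  qed
  then have "int (a s) dvd V t s" using t by simp
  moreover have "int (a s) dvd V z s" using insert.prems(6) by simp
  \<comment> \<open>All of \<open>T\<close> has coordinate \<open>s\<close> divisible by
    \<open>a s\<close>, so this coordinate of \<open>z\<close> sees only the power of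
    \<open>g s\<close>. Since \<open>V (g s) s\<close> is 1 modulo \<open>a s\<close>, it follows
    that \<open>a s\<close> divides \<open>k\<close>.\<close>
  ultimately have 1: "int (a s) dvd k * V (g s) s"
    by (simp add: Vz dvd_add_left_iff)
  have 2: "int (a s) dvd V (g s) s - 1"
    using insert.prems(4)[of s s] by simp
  have "k = k * V (g s) s - k * (V (g s) s - 1)" by (simp add: algebra_simps)
  then have "int (a s) dvd k"
    using 1 2 by (metis dvd_diff dvd_mult)
  then obtain q where q: "k = int (a s) * q" by blast
  have "g s [^] k = (g s [^] a s) [^] q"
    using gs by (simp add: q int_pow_pow[symmetric] int_pow_int)
  then have gk: "g s [^] k \<in> C"
    using insert.prems(3)[of s] C(1) by (simp add: subgroup_int_pow_closed)
  have "t \<in> C"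
  proof (rule insert.IH)
    show "t \<in> generate G (C \<union> g ` S)" using t by (simp add: T_def)
    show "int (a r) dvd V t r" if r: "r \<in> S" for r
    proof -
      have "int (a r) dvd V (g s [^] k) r"
        using gk insert.prems(1) r by simp
      then show ?thesis
        using insert.prems(6)[of r] r Vz[of r] by (simp add: V_pow dvd_add_right_iff)
    qed
  qed (use insert.prems in auto)
  then show ?case
    using gk z subgroup.m_closed[OF C(1)] by simp
qed

end

section \<open>The exterior square of a quotient by central coordinates\<close>

text \<open>\<open>\<phi>\<close> describes an isomorphism of \<open>P / N\<close> with the direct sum of the groups \<open>\<int> / a j\<close> for \<open>j < d\<close>
  (where \<open>\<int> / 0 = \<int>\<close>) by integer representatives of the coordinates. Surjectivity is stated on unit
  vectors only.\<close>

definition coords ::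
    "('f, 'b) monoid_scheme \<Rightarrow> 'f set \<Rightarrow> 'f set \<Rightarrow> nat \<Rightarrow> (nat \<Rightarrow> nat) \<Rightarrow> ('f \<Rightarrow> nat \<Rightarrow> int) \<Rightarrow> bool" where
  "coords F P N d a \<phi> \<longleftrightarrow>
     (\<forall>p\<in>P. \<forall>q\<in>P. \<forall>j<d. int (a j) dvd \<phi> (p \<otimes>\<^bsub>F\<^esub> q) j - (\<phi> p j + \<phi> q j)) \<and>
     (\<forall>p\<in>P. p \<in> N \<longleftrightarrow> (\<forall>j<d. int (a j) dvd \<phi> p j)) \<and>
     (\<forall>j<d. \<exists>p\<in>P. \<forall>i<d. int (a i) dvd \<phi> p i - (if i = j then 1 else 0))"

text \<open>The central extension of integer vectors by integer matrices with cocycle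
  \<open>u i * v j\<close>. Indices run over all of \<open>nat\<close>, so that one type serves
  every \<open>d\<close>.\<close>

definition heisenberg :: "((nat \<Rightarrow> int) \<times> (nat \<Rightarrow> nat \<Rightarrow> int)) monoid" where
  "heisenberg = \<lparr>carrier = UNIV,
     monoid.mult = (\<lambda>a b. (\<lambda>i. fst a i + fst b i, \<lambda>i j. snd a i j + snd b i j + fst a i * fst b j)),
     one = (\<lambda>_. 0, \<lambda>_ _. 0)\<rparr>"

lemma heisenberg_simps [simp]:
  "carrier heisenberg = UNIV"
  "x \<otimes>\<^bsub>heisenberg\<^esub> y =
    (\<lambda>i. fst x i + fst y i, \<lambda>i j. snd x i j + snd y i j + fst x i * fst y j)"
  "\<one>\<^bsub>heisenberg\<^esub> = (\<lambda>_. 0, \<lambda>_ _. 0)"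
  by (simp_all add: heisenberg_def)

lemma group_heisenberg [simp]: "group heisenberg"
proof (rule groupI)
  fix x assume "x \<in> carrier heisenberg"
  show "\<exists>y\<in>carrier heisenberg. y \<otimes>\<^bsub>heisenberg\<^esub> x = \<one>\<^bsub>heisenberg\<^esub>"
    by (intro bexI[of _ "(\<lambda>i. - fst x i, \<lambda>i j. fst x i * fst x j - snd x i j)"]) auto
qed (auto simp: algebra_simps)

lemma inv_heisenberg [simp]:
  "inv\<^bsub>heisenberg\<^esub> x = (\<lambda>i. - fst x i, \<lambda>i j. fst x i * fst x j - snd x i j)"
  by (rule group.inv_equality) auto

text \<open>The coordinates \<open>\<phi>\<close> are additive only modulo the \<open>a j\<close>.
  Lifting replaces them by congruent integers \<open>A\<close> that are exactly additive, and adds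
  central coordinates \<open>B\<close> whose defect of additivity is a product of values of
  \<open>A\<close>.\<close>

lemma coords_lift_heisenberg:
  assumes F: "group F" "free_basis F S" and P: "subgroup P F" and co: "coords F P N d a \<phi>"
  shows "\<exists>A B. (\<forall>p\<in>P. \<forall>q\<in>P. (\<forall>i. A (p \<otimes>\<^bsub>F\<^esub> q) i = A p i + A q i) \<and>
      (\<forall>i j. B (p \<otimes>\<^bsub>F\<^esub> q) i j = B p i j + B q i j + A p i * A q j)) \<and> coords F P N d a A"
proof -
  interpret F: group F by fact
  interpret P: subgroup P F by fact
  have mult: "int (a j) dvd \<phi> (p \<otimes>\<^bsub>F\<^esub> q) j - (\<phi> p j + \<phi> q j)" if "p \<in> P" "q \<in> P" "j < d" for p q j
    using co that by (auto simp: coords_def)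
  \<comment> \<open>The central part is left unconstrained. \<open>\<rho>\<close> is a subgroup
    because \<open>\<phi>\<close> is a homomorphism modulo the \<open>a j\<close>, and it is total
    because the vector \<open>\<phi> p\<close> itself is a permitted value.\<close>
  define \<rho> :: "('a \<times> (nat \<Rightarrow> int) \<times> (nat \<Rightarrow> nat \<Rightarrow> int)) set" where "\<rho> = {(p, x). p \<in> P \<and> (\<forall>j<d. int (a j) dvd fst x j - \<phi> p j)}"
  have \<rho>_mult: "(p \<otimes>\<^bsub>F\<^esub> q, x \<otimes>\<^bsub>heisenberg\<^esub> y) \<in> \<rho>" if "(p, x) \<in> \<rho>" "(q, y) \<in> \<rho>" for p q x y
  proof -
    have "int (a j) dvd fst x j + fst y j - \<phi> (p \<otimes>\<^bsub>F\<^esub> q) j" if "j < d" for j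
    proof -
      have *: "p \<in> P" "q \<in> P" "int (a j) dvd fst x j - \<phi> p j" "int (a j) dvd fst y j - \<phi> q j"
        using \<open>(p, x) \<in> \<rho>\<close> \<open>(q, y) \<in> \<rho>\<close> that by (auto simp: \<rho>_def)
      show ?thesis
        using dvd_diff[OF dvd_add[OF *(3,4)] mult[OF *(1,2) that]] by (simp add: algebra_simps)
    qed
    then show ?thesis using that by (auto simp: \<rho>_def)
  qed
  have one: "int (a j) dvd \<phi> \<one>\<^bsub>F\<^esub> j" if "j < d" for j
    using mult[of "\<one>\<^bsub>F\<^esub>" "\<one>\<^bsub>F\<^esub>" j] that by simp
  have \<rho>_inv: "(inv\<^bsub>F\<^esub> p, inv\<^bsub>heisenberg\<^esub> x) \<in> \<rho>" if "(p, x) \<in> \<rho>" for p x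
  proof -
    have p: "p \<in> P" using that by (simp add: \<rho>_def)
    have "int (a j) dvd - fst x j - \<phi> (inv\<^bsub>F\<^esub> p) j" if j: "j < d" for j
    proof -
      have x: "int (a j) dvd fst x j - \<phi> p j"
        using \<open>(p, x) \<in> \<rho>\<close> j by (simp add: \<rho>_def)
      show ?thesis
        using dvd_diff[OF dvd_diff[OF mult[OF p P.m_inv_closed[OF p] j] one[OF j]] x] p
        by (simp add: algebra_simps minus_diff_commute)
    qed
    then show ?thesis using p by (simp add: \<rho>_def)
  qed
  have "subgroup \<rho> (F \<times>\<times> heisenberg)"
  proof
    show "\<rho> \<subseteq> carrier (F \<times>\<times> heisenberg)" by (auto simp: \<rho>_def)
    show "\<one>\<^bsub>F \<times>\<times> heisenberg\<^esub> \<in> \<rho>" using one by (simp add: \<rho>_def)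
  next
    fix x y assume "x \<in> \<rho>" "y \<in> \<rho>"
    then show "x \<otimes>\<^bsub>F \<times>\<times> heisenberg\<^esub> y \<in> \<rho>"
      unfolding mult_DirProd' using \<rho>_mult[of "fst x" "snd x" "fst y" "snd y"] by simp
  next
    fix x assume x: "x \<in> \<rho>"
    then have "fst x \<in> carrier F" by (auto simp: \<rho>_def)
    then have "inv\<^bsub>F \<times>\<times> heisenberg\<^esub> x = (inv\<^bsub>F\<^esub> fst x, inv\<^bsub>heisenberg\<^esub> snd x)"
      using inv_DirProd[OF F(1) group_heisenberg, of "fst x" "snd x"] by simp
    then show "inv\<^bsub>F \<times>\<times> heisenberg\<^esub> x \<in> \<rho>"
      using \<rho>_inv[of "fst x" "snd x"] x by (simp del: inv_heisenberg)
  qed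
  moreover have "\<exists>x. (p, x) \<in> \<rho>" if "p \<in> P" for p
    using that by (intro exI[of _ "(\<phi> p, \<lambda>_ _. 0)"]) (simp add: \<rho>_def)
  ultimately obtain h where h: "h \<in> hom (F\<lparr>carrier := P\<rparr>) heisenberg" "\<And>p. p \<in> P \<Longrightarrow> (p, h p) \<in> \<rho>"
    using free_subgroup_lift[OF F P group_heisenberg, of \<rho>] by blast
  define A where "A p = fst (h p)" for p
  define B where "B p = snd (h p)" for p
  have h_mult: "h (p \<otimes>\<^bsub>F\<^esub> q) = h p \<otimes>\<^bsub>heisenberg\<^esub> h q" if "p \<in> P" "q \<in> P" for p q
    using hom_mult[OF h(1), of p q] that by simp
  have eqs: "\<forall>p\<in>P. \<forall>q\<in>P. (\<forall>i. A (p \<otimes>\<^bsub>F\<^esub> q) i = A p i + A q i) \<and>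
      (\<forall>i j. B (p \<otimes>\<^bsub>F\<^esub> q) i j = B p i j + B q i j + A p i * A q j)"
    by (simp add: A_def B_def h_mult)
  have A: "int (a j) dvd A p j - \<phi> p j" if "p \<in> P" "j < d" for p j
    using h(2)[OF that(1)] that(2) by (simp add: \<rho>_def A_def)
  have A_iff: "int (a j) dvd A p j \<longleftrightarrow> int (a j) dvd \<phi> p j" if "p \<in> P" "j < d" for p j
    using dvd_add_right_iff[OF A[OF that], of "\<phi> p j"] by simp
  have A_iff': "int (a j) dvd A p j - c \<longleftrightarrow> int (a j) dvd \<phi> p j - c" if "p \<in> P" "j < d" for p j c
    using dvd_add_right_iff[OF A[OF that], of "\<phi> p j - c"] by simp
  have "coords F P N d a A"
    unfolding coords_def
  proof (intro conjI ballI allI impI)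
    fix j assume "j < d"
    then obtain p where p: "p \<in> P" "\<forall>i<d. int (a i) dvd \<phi> p i - (if i = j then 1 else 0)"
      using co by (auto simp: coords_def)
    then show "\<exists>p\<in>P. \<forall>i<d. int (a i) dvd A p i - (if i = j then 1 else 0)"
      by (intro bexI[of _ p]) (simp_all add: A_iff')
  qed (use co eqs in \<open>simp_all add: A_iff coords_def\<close>)
  with eqs show ?thesis by blast
qed

section \<open>Triangular numbers and the enumeration of pairs\<close>

lemma chi2_Suc: "chi2 (Suc j) = chi2 j + j"
proof -
  have "(Suc j)\<^sup>2 - Suc j = (j\<^sup>2 - j) + 2 * j"
    by (cases j) (simp_all add: power2_eq_square)
  then show ?thesis unfolding chi2_def by simp
qed

lemma chi2_mono: "i \<le> j \<Longrightarrow> chi2 i \<le> chi2 j"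
  by (induction rule: dec_induct) (simp_all add: chi2_Suc)

text \<open>The pairs \<open>i < j\<close> are numbered by \<open>chi2 j + i\<close>.\<close>

definition pair_snd :: "nat \<Rightarrow> nat" where
  "pair_snd q = (LEAST j. q < chi2 (Suc j))"

definition pair_fst :: "nat \<Rightarrow> nat" where
  "pair_fst q = q - chi2 (pair_snd q)"

lemma pair_snd_upper: "q < chi2 (Suc (pair_snd q))"
  \<comment> \<open>\<open>Suc q\<close> shows that the minimum exists:
    \<open>chi2 (Suc (Suc q)) = chi2 (Suc q) + Suc q\<close> exceeds \<open>q\<close>.\<close>
  unfolding pair_snd_def by (rule LeastI[of _ "Suc q"]) (simp add: chi2_Suc)

lemma pair_snd_lower: "chi2 (pair_snd q) \<le> q"
proof (cases "pair_snd q")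
  case 0
  then show ?thesis by (simp add: chi2_def)
next
  case (Suc j)
  then have "\<not> q < chi2 (Suc j)"
    unfolding pair_snd_def by (intro not_less_Least) simp
  then show ?thesis using Suc by simp
qed

lemma chi2_pair: "chi2 (pair_snd q) + pair_fst q = q"
  using pair_snd_lower by (simp add: pair_fst_def)

lemma pair_fst_less: "pair_fst q < pair_snd q"
  using pair_snd_upper[of q] chi2_pair[of q] by (simp add: chi2_Suc)

lemma pair_snd_le: "q < chi2 (Suc j) \<Longrightarrow> pair_snd q \<le> j"
  unfolding pair_snd_def by (rule Least_le)

lemma pair_snd_less: "q < chi2 d \<Longrightarrow> pair_snd q < d"
  using pair_snd_le[of q "d - 1"] by (cases d) (auto simp: chi2_def)

text \<open>This lets the divisibility chain of the moduli survive the passage to pairs.\<close>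

lemma pair_snd_mono: "p \<le> q \<Longrightarrow> pair_snd p \<le> pair_snd q"
  using pair_snd_upper[of q] by (intro pair_snd_le) simp

lemma pair_eq:
  assumes "i < j"
  shows "pair_snd (chi2 j + i) = j" "pair_fst (chi2 j + i) = i"
proof -
  have "pair_snd (chi2 j + i) \<le> j"
    using assms by (intro pair_snd_le) (simp add: chi2_Suc)
  moreover have "j \<le> pair_snd (chi2 j + i)"
  proof (rule ccontr)
    assume "\<not> ?thesis"
    then have "chi2 (Suc (pair_snd (chi2 j + i))) \<le> chi2 j" by (intro chi2_mono) simp
    then show False using pair_snd_upper[of "chi2 j + i"] by simp
  qed
  ultimately show "pair_snd (chi2 j + i) = j" by simp
  then show "pair_fst (chi2 j + i) = i" by (simp add: pair_fst_def)
qed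

lemma chi2_add_less: "i < j \<Longrightarrow> j < d \<Longrightarrow> chi2 j + i < chi2 d"
  using chi2_mono[of "Suc j" d] by (simp add: chi2_Suc)

section \<open>One step of the series: from \<open>P / N\<close> to
  \<open>[P,P] / [N,P]\<close>\<close>

text \<open>\<open>A\<close> and \<open>B\<close> are the components of a homomorphism from
  \<open>P\<close> to \<open>heisenberg\<close>. \<open>B\<close> is additive on
  \<open>D = [P,P]\<close>, because \<open>A\<close> vanishes there, and on \<open>D\<close> it
  provides the coordinates modulo \<open>C = [N,P]\<close>.\<close>

locale heisenberg_coords = group G for G (structure) +
  fixes P N :: "'a set" and d :: nat and a :: "nat \<Rightarrow> nat"
    and A :: "'a \<Rightarrow> nat \<Rightarrow> int" and B :: "'a \<Rightarrow> nat \<Rightarrow> nat \<Rightarrow> int"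
  assumes P: "P \<lhd> G" and N: "N \<lhd> G" and NP: "N \<subseteq> P"
    and dvd: "\<And>i j. i \<le> j \<Longrightarrow> j < d \<Longrightarrow> a j dvd a i"
    and A_mult: "\<And>p q i. p \<in> P \<Longrightarrow> q \<in> P \<Longrightarrow> A (p \<otimes> q) i = A p i + A q i"
    and B_mult: "\<And>p q i j. p \<in> P \<Longrightarrow> q \<in> P \<Longrightarrow> B (p \<otimes> q) i j = B p i j + B q i j + A p i * A q j"
    and co: "coords G P N d a A"
begin

sublocale P: normal P G by (rule P)
sublocale N: normal N G by (rule N)

lemma mem_N_iff: "p \<in> P \<Longrightarrow> p \<in> N \<longleftrightarrow> (\<forall>j<d. int (a j) dvd A p j)"
  using co by (simp add: coords_def)

lemma A_hom: "(\<lambda>p. A p i) \<in> hom (G\<lparr>carrier := P\<rparr>) integer_group"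
  by (rule homI) (simp_all add: A_mult)

lemma A_one: "A \<one> i = 0"
  using A_mult[of \<one> \<one> i] by simp

lemma A_inv: "p \<in> P \<Longrightarrow> A (inv p) i = - A p i"
  using A_mult[of p "inv p" i] A_one[of i] by simp

lemma A_int_pow: "p \<in> P \<Longrightarrow> A (p [^] (k::int)) i = k * A p i"
  using hom_int_pow[OF A_hom _ P.subgroup_is_group[OF is_group] group_integer_group, of p k i]
    int_pow_consistent[OF P.subgroup_axioms, of p k] by simp

lemma A_commutator: "p \<in> P \<Longrightarrow> q \<in> P \<Longrightarrow> A (commutator G p q) i = 0"
  by (simp add: commutator_def A_mult A_inv)

lemma commutator_mem_P: "p \<in> P \<Longrightarrow> q \<in> P \<Longrightarrow> commutator G p q \<in> P"
  by (simp add: commutator_def)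

lemma commutator_mem_N: "p \<in> P \<Longrightarrow> q \<in> P \<Longrightarrow> commutator G p q \<in> N"
  by (simp add: mem_N_iff commutator_mem_P A_commutator)

text \<open>When \<open>B\<close> is applied to \<open>[p,q] (q p) = p q\<close>, the terms
  \<open>B p\<close> and \<open>B q\<close> cancel, and the vanishing of \<open>A\<close> on
  \<open>[p,q]\<close> removes one mixed term. What remains is a minor, the coordinate of the wedge
  of \<open>p\<close> and \<open>q\<close>.\<close>

lemma B_commutator:
  assumes "p \<in> P" "q \<in> P"
  shows "B (commutator G p q) i j = A p i * A q j - A q i * A p j"
proof -
  have "B (commutator G p q \<otimes> (q \<otimes> p)) i j = B (p \<otimes> q) i j"
    using assms by (simp add: commutator_mult_swap)
  then show ?thesis
    using assms by (simp add: B_mult A_commutator commutator_mem_P)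
qed

definition "D = derived G P"
definition "C = commutator_subgroup G N P"

sublocale D: normal D G
  unfolding D_def by (rule derived_is_normal[OF P])
sublocale C: normal C G
  unfolding C_def by (rule commutator_subgroup_normal[OF N P])

lemma D_subset: "subgroup T G \<Longrightarrow> (\<And>p q. p \<in> P \<Longrightarrow> q \<in> P \<Longrightarrow> commutator G p q \<in> T) \<Longrightarrow> D \<subseteq> T"
  unfolding D_def derived_eq_commutator_subgroup by (rule commutator_subgroup_subset)

lemma commutator_mem_D: "p \<in> P \<Longrightarrow> q \<in> P \<Longrightarrow> commutator G p q \<in> D"
  unfolding D_def derived_eq_commutator_subgroup by (rule commutator_in_commutator_subgroup)

lemma D_sub_N: "D \<subseteq> N"
  by (rule D_subset[OF N.subgroup_axioms commutator_mem_N])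

lemma D_sub_P: "D \<subseteq> P"
  using D_sub_N NP by blast

lemma C_sub_D: "C \<subseteq> D"
  unfolding C_def using NP
  by (intro commutator_subgroup_subset[OF D.subgroup_axioms] commutator_mem_D) auto

lemma commutator_N_P: "n \<in> N \<Longrightarrow> p \<in> P \<Longrightarrow> commutator G n p \<in> C"
  unfolding C_def by (rule commutator_in_commutator_subgroup)

lemma commutator_P_N: "p \<in> P \<Longrightarrow> n \<in> N \<Longrightarrow> commutator G p n \<in> C"
  unfolding C_def using N.subset P.subset by (intro commutator_in_commutator_subgroup')

lemma A_D: "x \<in> D \<Longrightarrow> A x i = 0"
proof -
  assume x: "x \<in> D"
  have "subgroup {p \<in> P. A p i = 0} G"
    by (rule subgroupI) (auto simp: A_mult A_inv A_one intro!: exI[of _ \<one>])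
  then have "D \<subseteq> {p \<in> P. A p i = 0}"
    by (rule D_subset) (simp add: A_commutator commutator_mem_P)
  with x show ?thesis by blast
qed

lemma B_add: "x \<in> D \<Longrightarrow> y \<in> D \<Longrightarrow> B (x \<otimes> y) i j = B x i j + B y i j"
  using D_sub_P by (simp add: B_mult A_D subset_eq)

text \<open>Here the order of the moduli enters. For \<open>n\<close> in \<open>N\<close> the minor
  of \<open>n\<close> and \<open>p\<close> is a combination of \<open>A n i\<close> and
  \<open>A n j\<close>; the latter is divisible by \<open>a j\<close>, the former by
  \<open>a i\<close> and therefore by \<open>a j\<close>.\<close>

lemma B_C:
  assumes x: "x \<in> C" and ij: "i \<le> j" "j < d"
  shows "int (a j) dvd B x i j"
proof -
  let ?K = "{p \<in> D. int (a j) dvd B p i j}"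
  have one: "B \<one> i j = 0"
    using B_add[of \<one> \<one> i j] by simp
  have inv: "B (inv p) i j = - B p i j" if "p \<in> D" for p
    using B_add[of p "inv p" i j] one that by simp
  have "subgroup ?K G"
    by (rule subgroupI) (auto simp: one inv B_add intro!: exI[of _ \<one>])
  moreover have "commutator G n p \<in> ?K" if np: "n \<in> N" "p \<in> P" for n p
  proof -
    have n: "n \<in> P" using np NP by blast
    have "int (a j) dvd A n j"
      using mem_N_iff[OF n] np ij by simp
    moreover have "int (a j) dvd A n i"
      using mem_N_iff[OF n] np ij dvd[OF ij] dvd_trans[of "int (a j)" "int (a i)" "A n i"] by simp
    ultimately show ?thesis
      using n np by (simp add: B_commutator commutator_mem_D)
  qed
  ultimately have "C \<subseteq> ?K"
    unfolding C_def by (rule commutator_subgroup_subset)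
  with x show ?thesis by blast
qed

text \<open>A lift to \<open>P\<close> of the \<open>j\<close>-th standard generator of
  \<open>P / N\<close>; its integer coordinates are those of a unit vector only modulo the
  \<open>a i\<close>.\<close>

definition e :: "nat \<Rightarrow> 'a" where
  "e j = (SOME p. p \<in> P \<and> (\<forall>i<d. int (a i) dvd A p i - (if i = j then 1 else 0)))"

lemma e: "j < d \<Longrightarrow> e j \<in> P" "j < d \<Longrightarrow> i < d \<Longrightarrow> int (a i) dvd A (e j) i - (if i = j then 1 else 0)"
proof -
  have "e j \<in> P \<and> (\<forall>i<d. int (a i) dvd A (e j) i - (if i = j then 1 else 0))" if "j < d"
    unfolding e_def by (rule someI_ex) (use co that in \<open>simp only: coords_def Bex_def\<close>)
  then show "j < d \<Longrightarrow> e j \<in> P" "j < d \<Longrightarrow> i < d \<Longrightarrow> int (a i) dvd A (e j) i - (if i = j then 1 else 0)"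
    by auto
qed

text \<open>The coordinates of \<open>p\<close> are cleared one at a time, from the last to the
  first, by multiplying with powers of the \<open>e k\<close>; once all are divisible by their
  moduli, the element lies in \<open>N\<close>. In the induction \<open>k\<close> counts the
  coordinates not yet cleared.\<close>

lemma P_subset:
  assumes T: "subgroup T G" and NT: "N \<subseteq> T" and eT: "\<And>j. j < d \<Longrightarrow> e j \<in> T"
  shows "P \<subseteq> T"
proof -
  have "p \<in> T" if "p \<in> P" "k \<le> d" "\<And>j. k \<le> j \<Longrightarrow> j < d \<Longrightarrow> int (a j) dvd A p j" for p k
    using that
  proof (induction k arbitrary: p)
    case 0
    then show ?case using mem_N_iff[of p] NT by auto
  next
    case (Suc k)
    have ek: "e k \<in> P" "e k \<in> T" using e(1)[of k] eT[of k] Suc.prems(2) by auto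
    let ?c = "e k [^] A p k"
    have c: "?c \<in> P" "?c \<in> T"
      using subgroup_int_pow_closed[OF P.subgroup_axioms ek(1)] subgroup_int_pow_closed[OF T ek(2)] by auto
    have "p \<otimes> inv ?c \<in> T"
    proof (rule Suc.IH)
      show "int (a j) dvd A (p \<otimes> inv ?c) j" if j: "k \<le> j" "j < d" for j
      proof -
        have A: "A (p \<otimes> inv ?c) j = A p j - A p k * A (e k) j"
          using Suc.prems(1) c ek by (simp add: A_mult A_inv A_int_pow)
        show ?thesis
        proof (cases "j = k")
          case True
          have "int (a k) dvd A p k * (A (e k) k - 1)"
            using e(2)[of k k] j True by simp
          moreover have "A (p \<otimes> inv ?c) j = - (A p k * (A (e k) k - 1))"
            using True A by (simp add: algebra_simps)
          ultimately show ?thesis using True by simp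
        next
          case False
          then show ?thesis
            using e(2)[of k j] j Suc.prems(3)[of j] unfolding A by auto
        qed
      qed
    qed (use Suc.prems c in auto)
    then have "p \<otimes> inv ?c \<otimes> ?c \<in> T"
      using c(2) by (rule subgroup.m_closed[OF T])
    then show ?case
      using Suc.prems c by (simp add: m_assoc)
  qed
  from this[of _ d] show ?thesis by auto
qed

text \<open>Modulo \<open>C\<close> the commutator is multiplicative in its second argument: the
  correction in \<open>commutator_mult_right\<close> is a commutator of an element of
  \<open>P\<close> with one of \<open>N\<close>.\<close>

lemma commutator_preimage_subgroup:
  assumes T: "subgroup T G" and CT: "C \<subseteq> T" and x: "x \<in> P"
  shows "subgroup {y \<in> P. commutator G x y \<in> T} G"
proof (rule subgroupI)
  have *: "commutator G x (y \<otimes> z) \<in> T \<longleftrightarrow> commutator G x y \<otimes>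
      (commutator G y (commutator G x z) \<otimes> commutator G x z) \<in> T"
    "commutator G y (commutator G x z) \<in> T" if "y \<in> P" "z \<in> P" for y z
    using that x CT commutator_P_N commutator_mem_N by (auto simp: commutator_mult_right)
  show "y \<otimes> z \<in> {y \<in> P. commutator G x y \<in> T}"
    if "y \<in> {y \<in> P. commutator G x y \<in> T}" "z \<in> {y \<in> P. commutator G x y \<in> T}" for y z
    using that by (auto simp: * intro!: subgroup.m_closed[OF T])
  show "inv y \<in> {y \<in> P. commutator G x y \<in> T}" if y: "y \<in> {y \<in> P. commutator G x y \<in> T}" for y
  proof -
    let ?u = "commutator G x y" and ?v = "commutator G x (inv y)"
    let ?c = "commutator G y ?v"
    have yP: "y \<in> P" and u: "?u \<in> T" using y by auto
    have c: "?c \<in> T" using *(2)[of y "inv y"] yP by auto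
    have carr: "?u \<in> carrier G" "?v \<in> carrier G" "?c \<in> carrier G"
      using x yP by auto
    \<comment> \<open>Expanding the commutator of \<open>x\<close> with
      \<open>y \<otimes> inv y\<close> expresses \<open>?v\<close> by the inverses of
      \<open>?u\<close> and of a correction in \<open>C\<close>.\<close>
    have "?u \<otimes> (?c \<otimes> ?v) = \<one>"
      using commutator_mult_right[of x y "inv y"] x yP by (simp add: commutator_one)
    then have "?v = inv ?c \<otimes> inv ?u"
      using carr by (metis inv_equality inv_mult_group m_assoc m_closed inv_inv inv_closed inv_unique')
    then have "?v \<in> T"
      using subgroup.m_closed[OF T subgroup.m_inv_closed[OF T c] subgroup.m_inv_closed[OF T u]] by simp
    then show ?thesis using yP by simp
  qed
  show "{y \<in> P. commutator G x y \<in> T} \<noteq> {}"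
    using x subgroup.one_closed[OF T] by (auto simp: commutator_one intro!: exI[of _ \<one>])
qed auto

text \<open>\<open>P_subset\<close> is applied to one argument at a time, first with
  \<open>e i\<close> on the left and then with an arbitrary \<open>p\<close>. In between, inverting
  the commutator exchanges its arguments.\<close>

lemma D_generated:
  assumes T: "subgroup T G" and CT: "C \<subseteq> T"
    and eT: "\<And>i j. i < j \<Longrightarrow> j < d \<Longrightarrow> commutator G (e i) (e j) \<in> T"
  shows "D \<subseteq> T"
proof -
  have ee: "commutator G (e i) (e j) \<in> T" if ij: "i < d" "j < d" for i j
  proof (cases i j rule: linorder_cases)
    case equal
    then show ?thesis using e(1)[OF ij(1)] subgroup.one_closed[OF T] by (simp add: commutator_self)
  next
    case greater
    then have "inv (commutator G (e j) (e i)) \<in> T"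
      using ij eT by (intro subgroup.m_inv_closed[OF T])
    then show ?thesis using e(1) ij by (simp add: inv_commutator)
  qed (use eT ij in auto)
  have 1: "commutator G (e i) q \<in> T" if i: "i < d" and q: "q \<in> P" for i q
  proof -
    have "P \<subseteq> {y \<in> P. commutator G (e i) y \<in> T}"
      by (rule P_subset[OF commutator_preimage_subgroup[OF T CT e(1)[OF i]]])
        (use NP CT commutator_P_N e(1) i ee in auto)
    then show ?thesis using q by blast
  qed
  have 2: "commutator G q (e i) \<in> T" if i: "i < d" and q: "q \<in> P" for i q
    using subgroup.m_inv_closed[OF T 1[OF that]] e(1)[OF i] q by (simp add: inv_commutator)
  have 3: "commutator G p q \<in> T" if p: "p \<in> P" and q: "q \<in> P" for p q
  proof -
    have "P \<subseteq> {y \<in> P. commutator G p y \<in> T}"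
      by (rule P_subset[OF commutator_preimage_subgroup[OF T CT p]])
        (use NP CT commutator_P_N e(1) p 2 in auto)
    then show ?thesis using q by blast
  qed
  show ?thesis by (rule D_subset[OF T 3])
qed

text \<open>Multiplicativity modulo \<open>C\<close> is iterated; normality of \<open>C\<close>
  absorbs the conjugate of the correction that arises at each step.\<close>

lemma commutator_pow_mem_C:
  assumes x: "x \<in> P" and y: "y \<in> P"
  shows "commutator G x (y [^] (k::nat)) \<otimes> inv (commutator G x y [^] k) \<in> C"
proof (induction k)
  case 0
  then show ?case using x by (simp add: commutator_one)
next
  case (Suc k)
  define g where "g = commutator G x y"
  define u where "u = commutator G x (y [^] k)"
  define c where "c = commutator G (y [^] k) g"
  have yk: "y [^] k \<in> P"
    using subgroup_int_pow_closed[OF P.subgroup_axioms y, of "int k"] by (simp add: int_pow_int)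
  have g: "g \<in> N" "g \<in> carrier G" and u: "u \<in> carrier G" and c: "c \<in> C" "c \<in> carrier G"
    using commutator_mem_N[OF x y] x y yk commutator_P_N[OF yk] by (auto simp: g_def u_def c_def)
  have gk: "g [^] k \<in> carrier G" using g by simp
  have "commutator G x (y [^] Suc k) \<otimes> inv (g [^] Suc k) =
      (u \<otimes> inv (g [^] k)) \<otimes> (g [^] k \<otimes> c \<otimes> inv (g [^] k))"
    using x y yk g u c gk commutator_mult_right[of x "y [^] k" y]
    by (simp add: u_def[symmetric] g_def[symmetric] c_def[symmetric] inv_mult_group m_assoc inv_cancel_left)
  moreover have "u \<otimes> inv (g [^] k) \<in> C" using Suc by (simp add: u_def g_def)
  moreover have "g [^] k \<otimes> c \<otimes> inv (g [^] k) \<in> C" by (rule C.inv_op_closed2[OF gk c(1)])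
  ultimately show ?case by (simp add: g_def)
qed

text \<open>All coordinates of \<open>e j [^] a j\<close> are divisible by their moduli, so it lies
  in \<open>N\<close> and its commutator with \<open>e i\<close> in \<open>C\<close>. For
  \<open>i < j\<close> the exponent is the modulus that divides the other one.\<close>

lemma commutator_e_pow:
  assumes ij: "i < d" "j < d"
  shows "commutator G (e i) (e j) [^] a j \<in> C"
proof -
  let ?g = "commutator G (e i) (e j) [^] a j" and ?u = "commutator G (e i) (e j [^] a j)"
  have "int (a r) dvd A (e j [^] a j) r" if "r < d" for r
  proof -
    have "A (e j [^] a j) r = int (a j) * A (e j) r"
      using A_int_pow[OF e(1)[OF ij(2)], of "int (a j)" r] by (simp add: int_pow_int)
    then show ?thesis using e(2)[OF ij(2) that] by (cases "r = j") auto
  qed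
  moreover have "e j [^] a j \<in> P"
    using subgroup_int_pow_closed[OF P.subgroup_axioms e(1)[OF ij(2)], of "int (a j)"]
    by (simp add: int_pow_int)
  ultimately have "e j [^] a j \<in> N"
    by (simp add: mem_N_iff)
  then have u: "?u \<in> C" by (rule commutator_P_N[OF e(1)[OF ij(1)]])
  have "?u \<otimes> inv ?g \<in> C"
    by (rule commutator_pow_mem_C[OF e(1)[OF ij(1)] e(1)[OF ij(2)]])
  then have "inv (?u \<otimes> inv ?g) \<otimes> ?u \<in> C"
    using u by simp
  moreover have "inv (?u \<otimes> inv ?g) \<otimes> ?u = ?g"
    using e(1)[OF ij(1)] e(1)[OF ij(2)] by (simp add: inv_mult_group m_assoc)
  ultimately show ?thesis by simp
qed

lemma B_commutator_e:
  assumes ij: "i < j" "j < d" and rs: "r < s" "s < d"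
  shows "int (a s) dvd B (commutator G (e i) (e j)) r s - (if r = i \<and> s = j then 1 else 0)"
proof -
  let ?m = "int (a s)"
  let ?\<delta> = "\<lambda>x y :: nat. if x = y then 1 else 0 :: int"
  have eP: "e i \<in> P" "e j \<in> P" using e(1) ij by auto
  have 1: "?m dvd A (e x) s - ?\<delta> s x" if "x < d" for x
    using e(2)[OF that rs(2)] .
  have 2: "?m dvd A (e x) r - ?\<delta> r x" if "x < d" for x
  proof -
    have "?m dvd int (a r)" using dvd[of r s] rs by simp
    also have "\<dots> dvd A (e x) r - ?\<delta> r x" using e(2)[OF that, of r] rs by simp
    finally show ?thesis .
  qed
  have 3: "?m dvd A (e x) r * A (e y) s - ?\<delta> r x * ?\<delta> s y" if "x < d" "y < d" for x y
  proof -
    have "?m dvd (A (e x) r - ?\<delta> r x) * A (e y) s + ?\<delta> r x * (A (e y) s - ?\<delta> s y)"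
      by (intro dvd_add dvd_mult dvd_mult2 1 2 that)
    then show ?thesis by (simp add: algebra_simps)
  qed
  have "?m dvd (A (e i) r * A (e j) s - ?\<delta> r i * ?\<delta> s j) - (A (e j) r * A (e i) s - ?\<delta> r j * ?\<delta> s i)"
    using ij by (intro dvd_diff 3) auto
  \<comment> \<open>\<open>r = j\<close> and \<open>s = i\<close> would contradict
    \<open>i < j\<close> and \<open>r < s\<close>.\<close>
  moreover have "?\<delta> r j * ?\<delta> s i = 0" using ij rs by auto
  moreover have "?\<delta> r i * ?\<delta> s j = (if r = i \<and> s = j then 1 else 0)" by simp
  ultimately show ?thesis
    by (simp add: B_commutator[OF eP] algebra_simps)
qed

text \<open>The commutators of the \<open>e i\<close> bound \<open>D / C\<close> from above, with
  orders limited by \<open>commutator_e_pow\<close>. The coordinates \<open>B\<close> are dual to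
  them and divisible by the moduli on \<open>C\<close>, which bounds the quotient from below.
  \<open>generate_coords_kernel\<close> joins the two bounds.\<close>

lemma coords_derived:
  "coords G D C (chi2 d) (\<lambda>q. a (pair_snd q)) (\<lambda>p q. B p (pair_fst q) (pair_snd q))"
proof -
  let ?a = "\<lambda>q. a (pair_snd q)" and ?V = "\<lambda>p q. B p (pair_fst q) (pair_snd q)"
  let ?g = "\<lambda>q. commutator G (e (pair_fst q)) (e (pair_snd q))"
  let ?S = "{..<chi2 d}"
  have q_less: "pair_fst q < pair_snd q" "pair_snd q < d" "pair_fst q < d" if "q < chi2 d" for q
    using pair_fst_less pair_snd_less[OF that] by (auto intro: less_trans)
  have g_D: "?g q \<in> D" if "q < chi2 d" for q
    using q_less[OF that] e(1) by (intro commutator_mem_D)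
  have VC: "int (?a q) dvd ?V x q" if "x \<in> C" "q < chi2 d" for x q
    using q_less[OF that(2)] that(1) by (intro B_C) auto
  have g_unit: "int (?a r) dvd ?V (?g q) r - (if r = q then 1 else 0)"
    if "q < chi2 d" "r < chi2 d" for q r
  proof -
    have "(pair_fst r = pair_fst q \<and> pair_snd r = pair_snd q) \<longleftrightarrow> r = q"
      using chi2_pair[of q] chi2_pair[of r] by auto
    then show ?thesis
      using B_commutator_e[of "pair_fst q" "pair_snd q" "pair_fst r" "pair_snd r"]
        q_less[OF that(1)] q_less[OF that(2)] by simp
  qed
  have D_gen: "D \<subseteq> generate G (C \<union> ?g ` ?S)"
  proof (rule D_generated)
    show "subgroup (generate G (C \<union> ?g ` ?S)) G"
      using g_D by (intro generate_is_subgroup) auto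
    show "C \<subseteq> generate G (C \<union> ?g ` ?S)" by (auto intro: generate.incl)
    show "commutator G (e i) (e j) \<in> generate G (C \<union> ?g ` ?S)" if "i < j" "j < d" for i j
      using chi2_add_less[OF that] pair_eq[OF that(1)]
      by (intro generate.incl UnI2 image_eqI[of _ _ "chi2 j + i"]) auto
  qed
  have kernel: "z \<in> C" if z: "z \<in> D" "\<And>q. q < chi2 d \<Longrightarrow> int (?a q) dvd ?V z q" for z
  proof (rule generate_coords_kernel[of D C ?V ?S ?a ?g])
    show "commutator G x y \<in> C" if "x \<in> D" "y \<in> D" for x y
      using that D_sub_N D_sub_P by (intro commutator_N_P) auto
    show "(\<lambda>x. ?V x q) \<in> hom (G\<lparr>carrier := D\<rparr>) integer_group" for q
      by (rule homI) (simp_all add: B_add)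
    show "?g q [^] ?a q \<in> C" if "q \<in> ?S" for q
      using that q_less by (intro commutator_e_pow) auto
    show "int (?a r) dvd ?V (?g q) r - (if r = q then 1 else 0)" if "q \<in> ?S" "r \<in> ?S" for q r
      using g_unit that by simp
    show "z \<in> generate G (C \<union> ?g ` ?S)"
      using D_gen z(1) by (rule subsetD)
  qed (simp_all add: D.subgroup_axioms C.subgroup_axioms C_sub_D VC g_D z(2))
  show ?thesis
    unfolding coords_def
  proof (intro conjI ballI allI impI)
    fix q assume "q < chi2 d"
    then show "\<exists>p\<in>D. \<forall>i<chi2 d. int (?a i) dvd ?V p i - (if i = q then 1 else 0)"
      using g_D g_unit by (intro bexI[of _ "?g q"]) auto
  qed (use kernel VC in \<open>auto simp: B_add\<close>)
qed

end

section \<open>Iteration along the derived series\<close>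

lemma coords_derived_step:
  assumes F: "group F" "free_basis F S" and P: "P \<lhd> F" "N \<lhd> F" "N \<subseteq> P"
    and dvd: "\<And>i j. i \<le> j \<Longrightarrow> j < d \<Longrightarrow> a j dvd a i"
    and co: "coords F P N d a \<phi>"
  shows "\<exists>\<psi>. coords F (derived F P) (commutator_subgroup F N P) (chi2 d) (\<lambda>q. a (pair_snd q)) \<psi>"
proof -
  obtain A B where
    AB: "\<forall>p\<in>P. \<forall>q\<in>P. (\<forall>i. A (p \<otimes>\<^bsub>F\<^esub> q) i = A p i + A q i) \<and>
      (\<forall>i j. B (p \<otimes>\<^bsub>F\<^esub> q) i j = B p i j + B q i j + A p i * A q j)" "coords F P N d a A"
    using coords_lift_heisenberg[OF F normal_imp_subgroup[OF P(1)] co] by (elim exE conjE) (rule that)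
  interpret heisenberg_coords F P N d a A B
  proof (intro heisenberg_coords.intro heisenberg_coords_axioms.intro)
    show "a j dvd a i" if "i \<le> j" "j < d" for i j
      using that by (rule dvd)
  qed (use F(1) P AB in simp_all)
  show ?thesis
    using coords_derived unfolding D_def C_def by blast
qed

text \<open>For \<open>l \<ge> 1\<close> this is the left-normed commutator of \<open>R\<close> with
  the derived subgroups of index 0 to \<open>l - 1\<close>, the known denominator for solvable
  varieties.\<close>

primrec solvable_commutator :: "('a, 'b) monoid_scheme \<Rightarrow> 'a set \<Rightarrow> nat \<Rightarrow> 'a set" where
  "solvable_commutator F R 0 = R"
| "solvable_commutator F R (Suc l) =
    commutator_subgroup F (solvable_commutator F R l) ((derived F ^^ l) (carrier F))"

lemma (in group) derived_series_normal: "(derived G ^^ l) (carrier G) \<lhd> G"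
  by (induction l) (simp_all add: normal_self derived_is_normal)

lemma (in group) solvable_commutator_normal:
  "R \<lhd> G \<Longrightarrow> solvable_commutator G R l \<lhd> G"
  by (induction l) (simp_all add: commutator_subgroup_normal derived_series_normal)

lemma (in group) solvable_commutator_subset:
  assumes "R \<lhd> G"
  shows "solvable_commutator G R l \<subseteq> (derived G ^^ l) (carrier G)"
proof (induction l)
  case 0
  show ?case using subgroup.subset[OF normal_imp_subgroup[OF assms]] by simp
next
  case (Suc l)
  then show ?case
    by (simp add: derived_eq_commutator_subgroup[of "(derived G ^^ l) (carrier G)"] commutator_subgroup_mono)
qed

text \<open>An index after \<open>l\<close> steps is an iterated pair; its modulus is that of the
  original index reached by taking the larger entry \<open>l\<close> times.\<close>

lemma coords_derived_series:
  assumes F: "group F" "free_basis F S" and R: "R \<lhd> F"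
    and dvd: "\<And>i j. i \<le> j \<Longrightarrow> j < d \<Longrightarrow> a j dvd a i"
    and co: "coords F (carrier F) R d a \<phi>"
  shows "\<exists>\<psi>. coords F ((derived F ^^ l) (carrier F)) (solvable_commutator F R l)
    (h_exp l d) (a \<circ> (pair_snd ^^ l)) \<psi>"
proof -
  interpret group F by fact
  \<comment> \<open>The divisibility chain is carried through the induction because the next step
    depends on it.\<close>
  have "(\<forall>i j. i \<le> j \<longrightarrow> j < h_exp l d \<longrightarrow> a ((pair_snd ^^ l) j) dvd a ((pair_snd ^^ l) i)) \<and> ?thesis"
  proof (induction l)
    case 0
    then show ?case using dvd co by (auto simp: h_exp_def)
  next
    case (Suc l)
    then obtain \<psi> where \<psi>: "coords F ((derived F ^^ l) (carrier F)) (solvable_commutator F R l)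
      (h_exp l d) (a \<circ> (pair_snd ^^ l)) \<psi>" by blast
    have dvd': "a ((pair_snd ^^ l) j) dvd a ((pair_snd ^^ l) i)" if "i \<le> j" "j < h_exp l d" for i j
      using Suc that by blast
    have shift: "a \<circ> (pair_snd ^^ Suc l) = (\<lambda>q. (a \<circ> (pair_snd ^^ l)) (pair_snd q))"
      by (simp add: fun_eq_iff funpow_swap1)
    have "\<exists>\<psi>. coords F (derived F ((derived F ^^ l) (carrier F)))
        (commutator_subgroup F (solvable_commutator F R l) ((derived F ^^ l) (carrier F)))
        (chi2 (h_exp l d)) (\<lambda>q. (a \<circ> (pair_snd ^^ l)) (pair_snd q)) \<psi>"
      using dvd' by (intro coords_derived_step[OF F derived_series_normal solvable_commutator_normal[OF R]
            solvable_commutator_subset[OF R] _ \<psi>]) auto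
    moreover have "a ((pair_snd ^^ Suc l) j) dvd a ((pair_snd ^^ Suc l) i)"
      if ij: "i \<le> j" "j < h_exp (Suc l) d" for i j
      using dvd'[OF pair_snd_mono[OF ij(1)] pair_snd_less] ij(2)
      by (simp add: h_exp_def funpow_swap1)
    ultimately show ?case
      unfolding shift by (simp add: h_exp_def)
  qed
  then show ?thesis by blast
qed

section \<open>The Baer commutator subgroup of the solvable varieties\<close>

lemma (in group) conj_hom: "g \<in> carrier G \<Longrightarrow> (\<lambda>x. g \<otimes> x \<otimes> inv g) \<in> hom G G"
  by (rule homI) (simp_all add: m_assoc inv_cancel_left)

lemma (in group) word_val_conj:
  assumes "g \<in> carrier G" "f \<in> UNIV \<rightarrow> carrier G"
  shows "g \<otimes> word_val G f v \<otimes> inv g = word_val G (\<lambda>i. g \<otimes> f i \<otimes> inv g) v"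
  using word_val_hom[OF is_group is_group conj_hom[OF assms(1)], of v f] assms(2)
  by (auto simp: comp_def)

lemma (in group) verbal_subgroup_normal: "verbal_subgroup G V \<lhd> G"
  unfolding verbal_subgroup_def
proof (rule normal_generateI)
  show "{word_val G f v |f v. v \<in> V \<and> f \<in> UNIV \<rightarrow> carrier G} \<subseteq> carrier G"
    by (auto intro!: word_val_closed)
  fix h g assume "h \<in> {word_val G f v |f v. v \<in> V \<and> f \<in> UNIV \<rightarrow> carrier G}" and g: "g \<in> carrier G"
  then obtain f v where "h = word_val G f v" "v \<in> V" "f \<in> UNIV \<rightarrow> carrier G" by blast
  moreover from this have "(\<lambda>i. g \<otimes> f i \<otimes> inv g) \<in> UNIV \<rightarrow> carrier G" using g by auto
  ultimately show "g \<otimes> h \<otimes> inv g \<in> {word_val G f v |f v. v \<in> V \<and> f \<in> UNIV \<rightarrow> carrier G}"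
    using word_val_conj[OF g] by blast
qed

text \<open>Assignments into the quotient lift pointwise to \<open>G\<close>, so the values of a
  word in the quotient are the cosets of its values in \<open>G\<close>.\<close>

lemma (in normal) satisfies_laws_Mod_iff: "satisfies_laws (G Mod H) V \<longleftrightarrow> verbal_subgroup G V \<subseteq> H"
proof -
  let ?q = "\<lambda>x. H #> x"
  have word: "word_val (G Mod H) (?q \<circ> f) v = ?q (word_val G f v)" if "f \<in> UNIV \<rightarrow> carrier G" for f v
    using word_val_hom[OF is_group factorgroup_is_group r_coset_hom_Mod, of v f] that by auto
  have one_iff: "?q x = \<one>\<^bsub>G Mod H\<^esub> \<longleftrightarrow> x \<in> H" if "x \<in> carrier G" for x
    using that coset_join1[OF _ that subgroup_axioms] coset_join2[OF that subgroup_axioms] by auto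
  have "satisfies_laws (G Mod H) V \<longleftrightarrow> (\<forall>v\<in>V. \<forall>f \<in> UNIV \<rightarrow> carrier G. word_val G f v \<in> H)"
  proof
    assume L: "satisfies_laws (G Mod H) V"
    show "\<forall>v\<in>V. \<forall>f \<in> UNIV \<rightarrow> carrier G. word_val G f v \<in> H"
    proof (intro ballI)
      fix v and f :: "nat \<Rightarrow> 'a" assume v: "v \<in> V" and f: "f \<in> UNIV \<rightarrow> carrier G"
      have "?q \<circ> f \<in> UNIV \<rightarrow> carrier (G Mod H)"
        using f by (auto simp: carrier_FactGroup)
      then have "?q (word_val G f v) = \<one>\<^bsub>G Mod H\<^esub>"
        using L v word[OF f, of v] unfolding satisfies_laws_def by metis
      then show "word_val G f v \<in> H"
        using f by (subst (asm) one_iff) (auto intro!: word_val_closed)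
    qed
  next
    assume R: "\<forall>v\<in>V. \<forall>f \<in> UNIV \<rightarrow> carrier G. word_val G f v \<in> H"
    show "satisfies_laws (G Mod H) V"
      unfolding satisfies_laws_def
    proof (intro ballI)
      fix v and f :: "nat \<Rightarrow> 'a set" assume v: "v \<in> V" and f: "f \<in> UNIV \<rightarrow> carrier (G Mod H)"
      have "\<forall>i. \<exists>x\<in>carrier G. f i = ?q x"
        using f by (auto simp: carrier_FactGroup)
      then obtain k where k: "\<And>i. k i \<in> carrier G" "\<And>i. f i = ?q (k i)" by metis
      then have f: "f = ?q \<circ> k" and kG: "k \<in> UNIV \<rightarrow> carrier G" by auto
      have "word_val G k v \<in> H" using R v kG by blast
      then show "word_val (G Mod H) f v = \<one>\<^bsub>G Mod H\<^esub>"
        unfolding f word[OF kG] by (subst one_iff) auto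
    qed
  qed
  also have "\<dots> \<longleftrightarrow> verbal_subgroup G V \<subseteq> H"
  proof
    assume "\<forall>v\<in>V. \<forall>f \<in> UNIV \<rightarrow> carrier G. word_val G f v \<in> H"
    then show "verbal_subgroup G V \<subseteq> H"
      unfolding verbal_subgroup_def by (intro generate_subgroup_incl subgroup_axioms) blast
  next
    assume "verbal_subgroup G V \<subseteq> H"
    then show "\<forall>v\<in>V. \<forall>f \<in> UNIV \<rightarrow> carrier G. word_val G f v \<in> H"
      unfolding verbal_subgroup_def by (blast intro: generate.incl)
  qed
  finally show ?thesis .
qed

text \<open>\<open>V\<close> and the single law \<open>derived_word l 0\<close> hold in the same
  quotients of \<open>G\<close>, so their verbal subgroups lie in the same normal subgroups. Both
  are normal themselves, so each contains the other.\<close>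

lemma (in group) verbal_subgroup_solvable:
  assumes "defines_solvable_variety V l"
  shows "verbal_subgroup G V = (derived G ^^ l) (carrier G)"
proof -
  have gens: "{word_val G f v |f v. v \<in> {derived_word l 0} \<and> f \<in> UNIV \<rightarrow> carrier G} =
      (derived_set G ^^ l) (carrier G)"
    using derived_word_values[of l 0] by auto
  have W: "verbal_subgroup G {derived_word l 0} = (derived G ^^ l) (carrier G)"
    unfolding verbal_subgroup_def gens derived_series_generate ..
  have "verbal_subgroup G V \<subseteq> N \<longleftrightarrow> (derived G ^^ l) (carrier G) \<subseteq> N" if "N \<lhd> G" for N
  proof -
    interpret normal N G by fact
    show ?thesis
      unfolding W[symmetric] satisfies_laws_Mod_iff[symmetric]
      using defines_solvable_variety_iff[OF assms factorgroup_is_group]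
        satisfies_derived_word[OF factorgroup_is_group] by simp
  qed
  from this[OF verbal_subgroup_normal[of V]] this[OF derived_series_normal[of l]] show ?thesis
    by blast
qed

section \<open>Fibre squares and their derived series\<close>

lemma subgroup_hom_vimage:
  assumes "group G" "group H" "h \<in> hom G H" "subgroup T H"
  shows "subgroup {x \<in> carrier G. h x \<in> T} G"
proof -
  interpret group_hom G H h
    using assms by (simp add: group_hom_def group_hom_axioms_def)
  interpret T: subgroup T H by fact
  show ?thesis
    by (rule G.subgroupI) (auto intro!: exI[of _ "\<one>\<^bsub>G\<^esub>"])
qed

text \<open>The fibre product of \<open>P\<close> with itself over \<open>P / N\<close>. For
  \<open>N\<close> inside \<open>P\<close>, the pairs with first entry 1 give back \<open>N\<close>,
  so the derived series of one group can record two descending series at once.\<close>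

definition fibre_square :: "('a, 'b) monoid_scheme \<Rightarrow> 'a set \<Rightarrow> 'a set \<Rightarrow> ('a \<times> 'a) set" where
  "fibre_square G P N = {(x, y). x \<in> P \<and> y \<in> P \<and> y \<otimes>\<^bsub>G\<^esub> inv\<^bsub>G\<^esub> x \<in> N}"

context group
begin

lemma group_square: "group (G \<times>\<times> G)"
  by (intro DirProd_group is_group)

lemma commutator_square:
  assumes "x \<in> carrier G" "y \<in> carrier G" "x' \<in> carrier G" "y' \<in> carrier G"
  shows "commutator (G \<times>\<times> G) (x, y) (x', y') = (commutator G x x', commutator G y y')"
  using assms by (simp add: commutator_def inv_DirProd[OF is_group is_group])

lemma subgroup_fibre_square:
  assumes P: "P \<lhd> G" and N: "N \<lhd> G"
  shows "subgroup (fibre_square G P N) (G \<times>\<times> G)"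
proof -
  interpret P: normal P G by fact
  interpret N: normal N G by fact
  interpret GG: group "G \<times>\<times> G" by (rule group_square)
  show ?thesis
  proof (rule GG.subgroupI)
    fix a b assume "a \<in> fibre_square G P N" "b \<in> fibre_square G P N"
    then obtain x y x' y' where *: "a = (x, y)" "b = (x', y')" "x \<in> P" "y \<in> P" "x' \<in> P" "y' \<in> P"
      "y \<otimes> inv x \<in> N" "y' \<otimes> inv x' \<in> N" by (auto simp: fibre_square_def)
    have "(y \<otimes> (y' \<otimes> inv x') \<otimes> inv y) \<otimes> (y \<otimes> inv x) \<in> N"
      using N.m_closed[OF N.inv_op_closed2[of y "y' \<otimes> inv x'"] *(7)] * by simp
    also have "(y \<otimes> (y' \<otimes> inv x') \<otimes> inv y) \<otimes> (y \<otimes> inv x) = (y \<otimes> y') \<otimes> inv (x \<otimes> x')"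
      using * by (simp add: m_assoc inv_mult_group inv_cancel_left)
    finally show "a \<otimes>\<^bsub>G \<times>\<times> G\<^esub> b \<in> fibre_square G P N"
      using * by (simp add: fibre_square_def)
  next
    fix a assume "a \<in> fibre_square G P N"
    then obtain x y where *: "a = (x, y)" "x \<in> P" "y \<in> P" "y \<otimes> inv x \<in> N"
      by (auto simp: fibre_square_def)
    have "inv y \<otimes> inv (y \<otimes> inv x) \<otimes> inv (inv y) \<in> N"
      using * by (intro N.inv_op_closed2) auto
    also have "inv y \<otimes> inv (y \<otimes> inv x) \<otimes> inv (inv y) = inv y \<otimes> x"
      using * by (simp add: m_assoc inv_mult_group)
    finally show "inv\<^bsub>G \<times>\<times> G\<^esub> a \<in> fibre_square G P N"
      using * inv_DirProd[OF is_group is_group, of x y] by (simp add: fibre_square_def)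
  next
    show "fibre_square G P N \<noteq> {}"
      by (auto simp: fibre_square_def intro!: exI[of _ \<one>])
  qed (auto simp: fibre_square_def)
qed

lemma commutator_mult_left:
  assumes "x \<in> carrier G" "y \<in> carrier G" "z \<in> carrier G"
  shows "commutator G (x \<otimes> y) z =
    commutator G x (commutator G y z) \<otimes> commutator G y z \<otimes> commutator G x z"
  using assms by (simp add: commutator_def inv_mult_group m_assoc inv_cancel_left)

text \<open>In the expansion, every factor other than \<open>commutator G x x'\<close> is a
  commutator with an entry in \<open>N\<close>; the one standing to its right is moved across by
  normality.\<close>

lemma commutator_fibre:
  assumes P: "P \<lhd> G" and N: "N \<lhd> G"
    and x: "x \<in> P" "x' \<in> P" and n: "n \<in> N" "n' \<in> N" "n \<in> P" "n' \<in> P"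
  shows "commutator G (n \<otimes> x) (n' \<otimes> x') \<otimes> inv (commutator G x x') \<in> commutator_subgroup G N P"
proof -
  interpret P: normal P G by fact
  interpret N: normal N G by fact
  define C where "C = commutator_subgroup G N P"
  interpret C: normal C G
    unfolding C_def by (rule commutator_subgroup_normal[OF N P])
  have c: "commutator G p q \<in> P" if "p \<in> P" "q \<in> P" for p q
    using that by (simp add: commutator_def)
  have CN: "commutator G m p \<in> C" "commutator G p m \<in> C" if "m \<in> N" "p \<in> P" for m p
    unfolding C_def using that commutator_in_commutator_subgroup
      commutator_in_commutator_subgroup'[OF N.subset P.subset] by auto
  define g where "g = commutator G x (n' \<otimes> x')"
  define h where "h = commutator G x x'"
  define c1 where "c1 = commutator G n g"
  define c2 where "c2 = commutator G x n'"
  define c3 where "c3 = commutator G n' h"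
  define c4 where "c4 = commutator G n (n' \<otimes> x')"
  have gh: "g \<in> P" "h \<in> P" unfolding g_def h_def using x n by (auto intro!: c)
  have cC: "c1 \<in> C" "c2 \<in> C" "c3 \<in> C" "c4 \<in> C"
    unfolding c1_def c2_def c3_def c4_def
    using CN(1)[OF n(1) gh(1)] CN(2)[OF n(2) x(1)] CN(1)[OF n(2) gh(2)]
      CN(1)[OF n(1) P.m_closed[OF n(4) x(2)]] by auto
  have g: "g = c2 \<otimes> (c3 \<otimes> h)"
    unfolding g_def c2_def c3_def h_def using x n by (intro commutator_mult_right) auto
  have "commutator G (n \<otimes> x) (n' \<otimes> x') = c1 \<otimes> g \<otimes> c4"
    unfolding g_def c1_def c4_def using x n by (intro commutator_mult_left) auto
  also have "\<dots> \<otimes> inv h = c1 \<otimes> (c2 \<otimes> (c3 \<otimes> (h \<otimes> c4 \<otimes> inv h)))"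
    unfolding g using cC gh by (simp add: m_assoc)
  also have "\<dots> \<in> C"
    using C.m_closed[OF cC(1) C.m_closed[OF cC(2) C.m_closed[OF cC(3) C.inv_op_closed2[OF _ cC(4)]]]]
      gh by simp
  finally show ?thesis unfolding C_def h_def .
qed

lemma derived_fibre_square:
  assumes P: "P \<lhd> G" and N: "N \<lhd> G" and NP: "N \<subseteq> P"
  shows "derived (G \<times>\<times> G) (fibre_square G P N) =
    fibre_square G (derived G P) (commutator_subgroup G N P)"
    (is "?L = fibre_square G ?D ?C")
proof
  interpret P: normal P G by fact
  interpret N: normal N G by fact
  interpret GG: group "G \<times>\<times> G" by (rule group_square)
  interpret D: normal ?D G by (rule derived_is_normal[OF P])
  interpret C: normal ?C G by (rule commutator_subgroup_normal[OF N P])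
  have DP: "commutator G x y \<in> ?D" if "x \<in> P" "y \<in> P" for x y
    using that by (simp add: derived_eq_commutator_subgroup commutator_in_commutator_subgroup)
  show "?L \<subseteq> fibre_square G ?D ?C"
    unfolding GG.derived_eq_commutator_subgroup
  proof (rule GG.commutator_subgroup_subset)
    show "subgroup (fibre_square G ?D ?C) (G \<times>\<times> G)"
      by (rule subgroup_fibre_square[OF derived_is_normal[OF P] commutator_subgroup_normal[OF N P]])
    fix a b assume "a \<in> fibre_square G P N" "b \<in> fibre_square G P N"
    then obtain x y x' y' where *: "a = (x, y)" "b = (x', y')" "x \<in> P" "y \<in> P" "x' \<in> P" "y' \<in> P"
      "y \<otimes> inv x \<in> N" "y' \<otimes> inv x' \<in> N" by (auto simp: fibre_square_def)
    have "commutator G (y \<otimes> inv x \<otimes> x) (y' \<otimes> inv x' \<otimes> x') \<otimes> inv (commutator G x x') \<in> ?C"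
      using * by (intro commutator_fibre[OF P N]) auto
    then have "commutator G y y' \<otimes> inv (commutator G x x') \<in> ?C"
      using * by (simp add: m_assoc)
    then show "commutator (G \<times>\<times> G) a b \<in> fibre_square G ?D ?C"
      using * DP by (simp add: commutator_square fibre_square_def)
  qed
  have sub: "subgroup ?L (G \<times>\<times> G)"
    by (rule GG.derived_is_subgroup) (auto simp: fibre_square_def)
  have comm: "(commutator G x x', commutator G y y') \<in> ?L"
    if "(x, y) \<in> fibre_square G P N" "(x', y') \<in> fibre_square G P N" for x y x' y'
    using GG.commutator_in_commutator_subgroup[OF that] that commutator_square[of x y x' y']
    by (auto simp: GG.derived_eq_commutator_subgroup fibre_square_def)
  have "(\<lambda>x. (x, x)) \<in> hom G (G \<times>\<times> G)" "(\<lambda>x. (\<one>, x)) \<in> hom G (G \<times>\<times> G)"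
    by (auto simp: hom_def)
  note vimage = subgroup_hom_vimage[OF is_group group_square this(1) sub]
    subgroup_hom_vimage[OF is_group group_square this(2) sub]
  have "?D \<subseteq> {x \<in> carrier G. (x, x) \<in> ?L}"
    unfolding derived_eq_commutator_subgroup[of P]
  proof (rule commutator_subgroup_subset[OF vimage(1)])
    fix x y assume xy: "x \<in> P" "y \<in> P"
    then have "(commutator G x y, commutator G x y) \<in> ?L"
      by (intro comm) (auto simp: fibre_square_def)
    then show "commutator G x y \<in> {x \<in> carrier G. (x, x) \<in> ?L}"
      using xy by simp
  qed
  moreover have "?C \<subseteq> {x \<in> carrier G. (\<one>, x) \<in> ?L}"
  proof (rule commutator_subgroup_subset[OF vimage(2)])
    fix n p assume np: "n \<in> N" "p \<in> P"
    \<comment> \<open>The commutator of \<open>(\<one>, n)\<close> with the diagonal pair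
      \<open>(p, p)\<close>.\<close>
    have "(commutator G \<one> p, commutator G n p) \<in> ?L"
      using np NP by (intro comm) (auto simp: fibre_square_def)
    then show "commutator G n p \<in> {x \<in> carrier G. (\<one>, x) \<in> ?L}"
      using np by (simp add: commutator_def)
  qed
  ultimately have DC: "(x, x) \<in> ?L" "(\<one>, c) \<in> ?L" if "x \<in> ?D" "c \<in> ?C" for x c
    using that by auto
  show "fibre_square G ?D ?C \<subseteq> ?L"
  proof
    fix a assume "a \<in> fibre_square G ?D ?C"
    then obtain x y where *: "a = (x, y)" "x \<in> ?D" "y \<in> ?D" "y \<otimes> inv x \<in> ?C"
      by (auto simp: fibre_square_def)
    \<comment> \<open>This product is the pair \<open>(x, y)\<close>: an element of the
      second-factor copy of \<open>?C\<close> times a diagonal pair.\<close>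
    have "(\<one>, y \<otimes> inv x) \<otimes>\<^bsub>G \<times>\<times> G\<^esub> (x, x) \<in> ?L"
      using DC * by (intro subgroup.m_closed[OF sub]) auto
    then show "a \<in> ?L"
      using * by (simp add: m_assoc)
  qed
qed

lemma derived_series_fibre_square:
  assumes R: "R \<lhd> G"
  defines "K \<equiv> (G \<times>\<times> G)\<lparr>carrier := fibre_square G (carrier G) R\<rparr>"
  shows "(derived K ^^ l) (carrier K) =
    fibre_square G ((derived G ^^ l) (carrier G)) (solvable_commutator G R l)"
proof (induction l)
  case 0
  then show ?case by (simp add: K_def)
next
  case (Suc l)
  let ?H = "fibre_square G ((derived G ^^ l) (carrier G)) (solvable_commutator G R l)"
  interpret GG: group "G \<times>\<times> G" by (rule group_square)
  have K: "subgroup (fibre_square G (carrier G) R) (G \<times>\<times> G)"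
    by (rule subgroup_fibre_square[OF normal_self R])
  then have "group K" unfolding K_def by (rule GG.subgroup_imp_group)
  then have "?H \<subseteq> carrier K"
    using group.exp_of_derived_in_carrier[of K "carrier K" l] Suc by simp
  then have "derived K ?H = derived (G \<times>\<times> G) ?H"
    unfolding K_def using GG.derived_consistent[OF _ K] by simp
  then show ?case
    using Suc derived_fibre_square[OF derived_series_normal solvable_commutator_normal[OF R]
        solvable_commutator_subset[OF R]] by simp
qed

section \<open>Independence of the Baer commutator subgroup from the set of words\<close>

lemma baer_commutator_normal:
  assumes R: "R \<lhd> G"
  shows "baer_commutator G R V \<lhd> G"
  unfolding baer_commutator_def
proof (rule normal_generateI)
  interpret R: normal R G by fact
  let ?S = "{word_val G (f(i := f i \<otimes> r)) v \<otimes> inv word_val G f v |f i r v.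
    f \<in> UNIV \<rightarrow> carrier G \<and> r \<in> R \<and> v \<in> V}"
  have upd: "f(i := f i \<otimes> r) \<in> UNIV \<rightarrow> carrier G" if "f \<in> UNIV \<rightarrow> carrier G" "r \<in> R" for f :: "nat \<Rightarrow> 'a" and i r
    using that by (auto simp: Pi_iff)
  show "?S \<subseteq> carrier G"
    using upd by (auto intro!: word_val_closed m_closed inv_closed) (auto simp: Pi_iff)
  fix h g assume "h \<in> ?S" and g: "g \<in> carrier G"
  then obtain f i r v where h: "h = word_val G (f(i := f i \<otimes> r)) v \<otimes> inv word_val G f v"
    and f: "f \<in> UNIV \<rightarrow> carrier G" and r: "r \<in> R" and v: "v \<in> V" by blast
  let ?f = "\<lambda>j. g \<otimes> f j \<otimes> inv g" and ?r = "g \<otimes> r \<otimes> inv g"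
  have fG: "f j \<in> carrier G" for j using f by auto
  have carr: "word_val G (f(i := f i \<otimes> r)) v \<in> carrier G" "word_val G f v \<in> carrier G"
    using upd[OF f r] f by (auto intro!: word_val_closed simp: Pi_iff r)
  have "(\<lambda>j. g \<otimes> (f(i := f i \<otimes> r)) j \<otimes> inv g) = ?f(i := ?f i \<otimes> ?r)"
    using g fG r by (auto simp: m_assoc inv_cancel_left)
  moreover have "g \<otimes> h \<otimes> inv g = (g \<otimes> word_val G (f(i := f i \<otimes> r)) v \<otimes> inv g) \<otimes>
      inv (g \<otimes> word_val G f v \<otimes> inv g)"
    unfolding h using g carr by (simp add: m_assoc inv_mult_group inv_cancel_left)
  ultimately have "g \<otimes> h \<otimes> inv g = word_val G (?f(i := ?f i \<otimes> ?r)) v \<otimes> inv word_val G ?f v"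
    by (simp only: word_val_conj[OF g f] word_val_conj[OF g upd[OF f r]])
  moreover have "?f \<in> UNIV \<rightarrow> carrier G" "?r \<in> R"
    using g fG R.inv_op_closed2[OF g r] by auto
  ultimately show "g \<otimes> h \<otimes> inv g \<in> ?S" using v by blast
qed

text \<open>A generator changes one variable. Only the finitely many variables of \<open>v\<close>
  matter, so a simultaneous change is a finite telescoping product of such changes.\<close>

lemma word_val_baer_commutator:
  assumes R: "R \<lhd> G" and v: "v \<in> V" and f: "f \<in> UNIV \<rightarrow> carrier G" "f' \<in> UNIV \<rightarrow> carrier G"
    and rel: "\<And>i. f' i \<otimes> inv f i \<in> R"
  shows "word_val G f' v \<otimes> inv word_val G f v \<in> baer_commutator G R V"
proof -
  interpret R: normal R G by fact
  let ?N = "baer_commutator G R V"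
  interpret N: normal ?N G by (rule baer_commutator_normal[OF R])
  have fG: "f i \<in> carrier G" "f' i \<in> carrier G" for i using f by auto
  have "word_val G (\<lambda>i. if i \<in> I then f' i else f i) v \<otimes> inv word_val G f v \<in> ?N" if "finite I" for I
    using that
  proof induction
    case empty
    then show ?case using fG by (simp add: word_val_closed)
  next
    case (insert i I)
    define k where "k j = (if j \<in> I then f' j else f j)" for j
    have kG: "k j \<in> carrier G" for j using fG by (simp add: k_def)
    \<comment> \<open>Generators multiply by elements of \<open>R\<close> on the right, while
      \<open>rel\<close> has the quotient on the left; normality of \<open>R\<close> converts one
      into the other.\<close>
    let ?r = "inv k i \<otimes> f' i"
    have "?r \<in> R"
      using R.inv_op_closed1[OF fG(1)[of i] rel[of i]] fG[of i] insert.hyps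
      by (simp add: k_def m_assoc)
    then have "word_val G (k(i := k i \<otimes> ?r)) v \<otimes> inv word_val G k v \<in> ?N"
      unfolding baer_commutator_def using kG v by (intro generate.incl) blast
    moreover have "k(i := k i \<otimes> ?r) = (\<lambda>j. if j \<in> insert i I then f' j else f j)"
      using kG fG by (auto simp: inv_cancel_left k_def)
    moreover have "word_val G k v \<otimes> inv word_val G f v \<in> ?N"
      using insert.IH by (simp add: k_def[abs_def])
    ultimately have "(word_val G (\<lambda>j. if j \<in> insert i I then f' j else f j) v \<otimes> inv word_val G k v) \<otimes>
        (word_val G k v \<otimes> inv word_val G f v) \<in> ?N"
      by (metis N.m_closed)
    then show ?case
      using kG fG by (simp add: m_assoc word_val_closed inv_cancel_left)
  qed
  from this[of "snd ` set v"]
  have "word_val G (\<lambda>i. if i \<in> snd ` set v then f' i else f i) v \<otimes> inv word_val G f v \<in> ?N" by simp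
  also have "word_val G (\<lambda>i. if i \<in> snd ` set v then f' i else f i) v = word_val G f' v"
    by (rule word_val_cong) simp
  finally show ?thesis .
qed

text \<open>The subgroup \<open>[R V\<^sup>* F]\<close> is the kernel of the first projection of the verbal subgroup of
  \<open>F \<times>\<^bsub>F/R\<^esub> F\<close>; in particular it depends on the variety only.\<close>

lemma baer_commutator_solvable:
  assumes R: "R \<lhd> G" and V: "defines_solvable_variety V l"
  shows "baer_commutator G R V = solvable_commutator G R l"
proof
  interpret R: normal R G by fact
  let ?N = "baer_commutator G R V" and ?N' = "solvable_commutator G R l"
    and ?P = "(derived G ^^ l) (carrier G)"
  interpret N: normal ?N G by (rule baer_commutator_normal[OF R])
  interpret N': normal ?N' G by (rule solvable_commutator_normal[OF R])
  interpret P: normal ?P G by (rule derived_series_normal)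
  interpret GG: group "G \<times>\<times> G" by (rule group_square)
  define K where "K = (G \<times>\<times> G)\<lparr>carrier := fibre_square G (carrier G) R\<rparr>"
  have K_sub: "subgroup (fibre_square G (carrier G) R) (G \<times>\<times> G)"
    by (rule subgroup_fibre_square[OF normal_self R])
  then interpret K: group K unfolding K_def by (rule GG.subgroup_imp_group)
  have K_carr: "carrier K = fibre_square G (carrier G) R" by (simp add: K_def)
  have verbal: "verbal_subgroup K V = fibre_square G ?P ?N'"
    unfolding K.verbal_subgroup_solvable[OF V] unfolding K_def by (rule derived_series_fibre_square[OF R])
  have "fst \<in> hom K G" "snd \<in> hom K G"
    by (auto simp: hom_def K_def fibre_square_def)
  note proj = word_val_hom[OF K.is_group is_group this(1)] word_val_hom[OF K.is_group is_group this(2)]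
  have word: "word_val K k v = (word_val G (fst \<circ> k) v, word_val G (snd \<circ> k) v)"
    if "k \<in> UNIV \<rightarrow> carrier K" for k and v :: "nat word"
    using proj[of v k] that by (intro prod_eqI) (auto simp: Pi_iff)
  show "?N \<subseteq> ?N'"
    unfolding baer_commutator_def
  proof (intro generate_subgroup_incl N'.subgroup_axioms subsetI)
    fix h assume "h \<in> {word_val G (f(i := f i \<otimes> r)) v \<otimes> inv word_val G f v |f i r v.
      f \<in> UNIV \<rightarrow> carrier G \<and> r \<in> R \<and> v \<in> V}"
    then obtain f i r v where h: "h = word_val G (f(i := f i \<otimes> r)) v \<otimes> inv word_val G f v"
      and f: "f \<in> UNIV \<rightarrow> carrier G" and r: "r \<in> R" and v: "v \<in> V" by blast
    have fG: "f j \<in> carrier G" for j using f by auto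
    \<comment> \<open>Pairing the two assignments of a generator gives an assignment into
      \<open>K\<close>; the quotient of the components of its word value is
      \<open>h\<close>.\<close>
    define k where "k j = (f j, (f(i := f i \<otimes> r)) j)" for j
    have "k \<in> UNIV \<rightarrow> carrier K"
      using fG r R.inv_op_closed2[OF fG r] by (auto simp: k_def K_carr fibre_square_def)
    then have "word_val K k v \<in> verbal_subgroup K V"
      unfolding verbal_subgroup_def using v by (intro generate.incl) blast
    moreover have "fst \<circ> k = f" "snd \<circ> k = f(i := f i \<otimes> r)"
      by (auto simp: k_def)
    ultimately show "h \<in> ?N'"
      using word[OF \<open>k \<in> UNIV \<rightarrow> carrier K\<close>, of v] h by (simp add: verbal fibre_square_def)
  qed
  \<comment> \<open>Conversely, the components of every verbal element of \<open>K\<close> differ by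
    an element of \<open>?N\<close>. Applied to the pairs \<open>(\<one>, c)\<close>, this gives the
    other inclusion.\<close>
  have "verbal_subgroup K V \<subseteq> fibre_square G (carrier G) ?N"
  proof -
    have sub: "subgroup (fibre_square G (carrier G) ?N) (G \<times>\<times> G)"
      by (rule subgroup_fibre_square[OF normal_self N.normal_axioms])
    have "(\<lambda>x. x) \<in> hom K (G \<times>\<times> G)"
      using subgroup.subset[OF K_sub] by (auto simp: hom_def K_def)
    then have "subgroup {x \<in> carrier K. x \<in> fibre_square G (carrier G) ?N} K"
      by (rule subgroup_hom_vimage[OF K.is_group group_square _ sub])
    moreover have "word_val K k v \<in> fibre_square G (carrier G) ?N"
      if v: "v \<in> V" and k: "k \<in> UNIV \<rightarrow> carrier K" for k v
    proof -
      have kj: "fst (k j) \<in> carrier G" "snd (k j) \<in> carrier G" "snd (k j) \<otimes> inv fst (k j) \<in> R" for j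
        using k by (auto simp: Pi_iff K_carr fibre_square_def split_beta)
      then have "word_val G (snd \<circ> k) v \<otimes> inv word_val G (fst \<circ> k) v \<in> ?N"
        using v by (intro word_val_baer_commutator[OF R]) auto
      then show ?thesis
        using kj by (auto simp: word[OF k] fibre_square_def intro!: word_val_closed)
    qed
    ultimately have "verbal_subgroup K V \<subseteq> {x \<in> carrier K. x \<in> fibre_square G (carrier G) ?N}"
      unfolding verbal_subgroup_def
      by (intro K.generate_subgroup_incl) (auto intro!: K.word_val_closed simp: Pi_iff)
    then show ?thesis by blast
  qed
  moreover have "(\<one>, c) \<in> verbal_subgroup K V" if "c \<in> ?N'" for c
    using that solvable_commutator_subset[OF R, of l] by (auto simp: verbal fibre_square_def)
  ultimately have *: "(\<one>, c) \<in> fibre_square G (carrier G) ?N" if "c \<in> ?N'" for c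
    using that by blast
  show "?N' \<subseteq> ?N"
  proof
    fix c assume "c \<in> ?N'"
    then show "c \<in> ?N" using *[of c] by (simp add: fibre_square_def)
  qed
qed

end

section \<open>From coordinates to direct sums\<close>

text \<open>The form with \<open>mod\<close> also covers \<open>n = 0\<close>, where the group is
  that of all integers and \<open>x mod 0 = x\<close>.\<close>

lemma carrier_integer_mod_group_iff: "x \<in> carrier (integer_mod_group n) \<longleftrightarrow> x mod int n = x"
proof (cases "n = 0")
  case False
  then have "0 < int n" by simp
  then show ?thesis
    using False pos_mod_bound[of "int n" x] pos_mod_sign[of "int n" x]
    by (auto simp: carrier_integer_mod_group simp del: pos_mod_bound pos_mod_sign)
qed (simp add: carrier_integer_mod_group)

lemma direct_power_integer_mod_group:
  "x \<in> carrier (direct_power (integer_mod_group n) r) \<longleftrightarrow>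
    x \<in> extensional {..<r} \<and> (\<forall>i<r. x i mod int n = x i)"
  by (auto simp: direct_power_def carrier_sum_group PiE_iff carrier_integer_mod_group_iff)

lemma direct_power_integer_group:
  "x \<in> carrier (direct_power integer_group r) \<longleftrightarrow> x \<in> extensional {..<r}"
  by (auto simp: direct_power_def carrier_sum_group PiE_iff)

lemma group_direct_power [simp]: "group A \<Longrightarrow> group (direct_power A r)"
  by (simp add: direct_power_def)

text \<open>The free summands come first, with modulus 0: everything divides 0, so the chain of the
  \<open>n i\<close> extends to them. The shift \<open>Suc j - m\<close> accounts for
  \<open>n\<close> being indexed from 1.\<close>

lemma coords_of_iso:
  assumes F: "group F" and R: "R \<lhd> F"
    and iso: "F Mod R \<cong> direct_power integer_group m \<times>\<times> sum_group {1..k} (\<lambda>i. integer_mod_group (n i))"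
  shows "\<exists>\<phi>. coords F (carrier F) R (m + k) (\<lambda>j. if j < m then 0 else n (Suc j - m)) \<phi>"
proof -
  interpret F: group F by fact
  interpret R: normal R F by fact
  let ?T1 = "direct_power integer_group m" and ?T2 = "sum_group {1..k} (\<lambda>i. integer_mod_group (n i))"
  let ?T = "?T1 \<times>\<times> ?T2"
  let ?a = "\<lambda>j. if j < m then 0 else n (Suc j - m)"
  have T1: "x \<in> carrier ?T1 \<longleftrightarrow> x \<in> extensional {..<m}" for x
    by (rule direct_power_integer_group)
  have T2: "x \<in> carrier ?T2 \<longleftrightarrow> x \<in> extensional {1..k} \<and> (\<forall>i\<in>{1..k}. x i mod int (n i) = x i)" for x
    by (auto simp: carrier_sum_group PiE_iff carrier_integer_mod_group_iff)
  have T: "group ?T" by (intro DirProd_group) simp_all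
  obtain h where h: "h \<in> hom (F Mod R) ?T" "bij_betw h (carrier (F Mod R)) (carrier ?T)"
    using iso by (auto simp: is_iso_def iso_def)
  define H where "H p = h (R #>\<^bsub>F\<^esub> p)" for p
  have "(h \<circ> (\<lambda>p. R #>\<^bsub>F\<^esub> p)) \<in> hom F ?T"
    by (rule hom_compose[OF R.r_coset_hom_Mod h(1)])
  then have H_hom: "H \<in> hom F ?T" by (simp add: H_def[abs_def] comp_def)
  have H_mult: "H (p \<otimes>\<^bsub>F\<^esub> q) = H p \<otimes>\<^bsub>?T\<^esub> H q" if "p \<in> carrier F" "q \<in> carrier F" for p q
    using H_hom that by (rule hom_mult)
  have H_carr: "fst (H p) \<in> carrier ?T1" "snd (H p) \<in> carrier ?T2" if "p \<in> carrier F" for p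
    using hom_in_carrier[OF H_hom that] by (auto simp: mem_Times_iff)
  have H_one: "H p = \<one>\<^bsub>?T\<^esub> \<longleftrightarrow> p \<in> R" if p: "p \<in> carrier F" for p
  proof -
    have "h (R #>\<^bsub>F\<^esub> p) = h \<one>\<^bsub>F Mod R\<^esub> \<longleftrightarrow> R #>\<^bsub>F\<^esub> p = \<one>\<^bsub>F Mod R\<^esub>"
    proof (rule inj_on_eq_iff[OF bij_betw_imp_inj_on[OF h(2)]])
      show "R #>\<^bsub>F\<^esub> p \<in> carrier (F Mod R)"
        using p by (simp add: carrier_FactGroup)
      show "\<one>\<^bsub>F Mod R\<^esub> \<in> carrier (F Mod R)"
        by (rule monoid.one_closed[OF group.is_monoid[OF R.factorgroup_is_group]])
    qed
    moreover have "h \<one>\<^bsub>F Mod R\<^esub> = \<one>\<^bsub>?T\<^esub>"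
      by (rule hom_one[OF h(1) R.factorgroup_is_group T])
    moreover have "R #>\<^bsub>F\<^esub> p = R \<longleftrightarrow> p \<in> R"
      using F.coset_join1[OF _ p R.subgroup_axioms] F.coset_join2[OF p R.subgroup_axioms] by blast
    ultimately show ?thesis by (simp add: H_def)
  qed
  have H_surj: "\<exists>p\<in>carrier F. H p = t" if "t \<in> carrier ?T" for t
  proof -
    have "t \<in> h ` (\<lambda>p. R #>\<^bsub>F\<^esub> p) ` carrier F"
      using bij_betw_imp_surj_on[OF h(2)] that unfolding carrier_FactGroup by blast
    then show ?thesis by (auto simp: H_def)
  qed
  define \<phi> where "\<phi> p j = (if j < m then fst (H p) j else snd (H p) (Suc j - m))" for p j
  have ind: "Suc j - m \<in> {1..k}" if "j < m + k" "\<not> j < m" for j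
    using that by auto
  have "coords F (carrier F) R (m + k) ?a \<phi>"
    unfolding coords_def
  proof (intro conjI ballI allI impI)
    fix p q j assume pq: "p \<in> carrier F" "q \<in> carrier F" and j: "j < m + k"
    show "int (?a j) dvd \<phi> (p \<otimes>\<^bsub>F\<^esub> q) j - (\<phi> p j + \<phi> q j)"
    proof (cases "j < m")
      case True
      then show ?thesis
        by (simp add: \<phi>_def H_mult[OF pq] mult_DirProd' direct_power_def)
    next
      case False
      then show ?thesis
        using ind[OF j False]
        by (simp add: \<phi>_def H_mult[OF pq] mult_DirProd' mod_eq_dvd_iff[symmetric] del: atLeastAtMost_iff)
    qed
  next
    fix p assume p: "p \<in> carrier F"
    have "p \<in> R \<longleftrightarrow> fst (H p) = \<one>\<^bsub>?T1\<^esub> \<and> snd (H p) = \<one>\<^bsub>?T2\<^esub>"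
      using H_one[OF p] by (simp add: prod_eq_iff)
    also have "fst (H p) = \<one>\<^bsub>?T1\<^esub> \<longleftrightarrow> (\<forall>j<m. fst (H p) j = 0)"
      using H_carr(1)[OF p] unfolding T1
      by (auto simp: direct_power_def fun_eq_iff extensional_def)
    also have "snd (H p) = \<one>\<^bsub>?T2\<^esub> \<longleftrightarrow> (\<forall>i\<in>{1..k}. snd (H p) i = 0)"
      using H_carr(2)[OF p] unfolding T2
      by (auto simp: fun_eq_iff extensional_def)
    also have "\<dots> \<longleftrightarrow> (\<forall>i\<in>{1..k}. int (n i) dvd snd (H p) i)"
      using H_carr(2)[OF p] unfolding T2 by (metis dvd_0_right dvd_imp_mod_0)
    also have "(\<forall>j<m. fst (H p) j = 0) \<and> \<dots> \<longleftrightarrow> (\<forall>j<m + k. int (?a j) dvd \<phi> p j)"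
    proof safe
      fix j assume *: "\<forall>j<m. fst (H p) j = 0" "\<forall>i\<in>{1..k}. int (n i) dvd snd (H p) i" "j < m + k"
      then show "int (?a j) dvd \<phi> p j"
        using ind[of j] by (auto simp: \<phi>_def)
    next
      fix j assume "\<forall>j<m + k. int (?a j) dvd \<phi> p j" "j < m"
      then show "fst (H p) j = 0" by (auto simp: \<phi>_def dest!: spec[of _ j])
    next
      fix i assume *: "\<forall>j<m + k. int (?a j) dvd \<phi> p j" and i: "i \<in> {1..k}"
      then have "m + i - 1 < m + k" by auto
      with * have "int (?a (m + i - 1)) dvd \<phi> p (m + i - 1)" by blast
      moreover have "\<not> m + i - 1 < m" "Suc (m + i - 1) - m = i" using i by auto
      ultimately show "int (n i) dvd snd (H p) i" by (simp add: \<phi>_def del: One_nat_def)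
    qed
    finally show "p \<in> R \<longleftrightarrow> (\<forall>j<m + k. int (?a j) dvd \<phi> p j)" .
  next
    fix j assume j: "j < m + k"
    \<comment> \<open>The entry is \<open>1 mod int (n i)\<close> because for \<open>n i = 1\<close>
      the carrier contains only 0.\<close>
    let ?t = "(\<lambda>i\<in>{..<m}. if i = j then 1 else 0, \<lambda>i\<in>{1..k}. if m + i = Suc j then 1 mod int (n i) else 0)"
    have "fst ?t \<in> carrier ?T1" "snd ?t \<in> carrier ?T2"
      unfolding T1 T2 by simp_all
    then have "?t \<in> carrier ?T" by (simp only: carrier_DirProd mem_Times_iff)
    then obtain p where p: "p \<in> carrier F" "H p = ?t" using H_surj by blast
    have "int (?a i) dvd \<phi> p i - (if i = j then 1 else 0)" if i: "i < m + k" for i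
    proof (cases "i < m")
      case False
      then have "\<phi> p i = (if i = j then 1 mod int (?a i) else 0)"
        using ind[OF i False] by (auto simp: \<phi>_def p)
      then show ?thesis by (simp add: mod_eq_dvd_iff[symmetric])
    qed (simp add: \<phi>_def p)
    then show "\<exists>p\<in>carrier F. \<forall>i<m + k. int (?a i) dvd \<phi> p i - (if i = j then 1 else 0)"
      using p by blast
  qed
  then show ?thesis by blast
qed

text \<open>\<open>coords\<close> asks only for unit vectors; a product of their powers with
  exponents \<open>c k\<close> realises the vector \<open>c\<close>.\<close>

lemma coords_surj:
  assumes F: "group F" and P: "subgroup P F" and co: "coords F P N d a \<phi>"
  shows "\<exists>p\<in>P. \<forall>j<d. int (a j) dvd \<phi> p j - c j"
proof -
  interpret F: group F by fact
  interpret P: subgroup P F by fact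
  have mult: "int (a j) dvd \<phi> (p \<otimes>\<^bsub>F\<^esub> q) j - (\<phi> p j + \<phi> q j)" if "p \<in> P" "q \<in> P" "j < d" for p q j
    using co that by (auto simp: coords_def)
  \<comment> \<open>Reduced modulo \<open>a j\<close>, the coordinate is a homomorphism, which
    determines it on integer powers.\<close>
  have hom: "(\<lambda>p. \<phi> p j mod int (a j)) \<in> hom (F\<lparr>carrier := P\<rparr>) (integer_mod_group (a j))" if "j < d" for j
  proof (rule homI)
    fix p q assume "p \<in> carrier (F\<lparr>carrier := P\<rparr>)" "q \<in> carrier (F\<lparr>carrier := P\<rparr>)"
    then show "\<phi> (p \<otimes>\<^bsub>F\<lparr>carrier := P\<rparr>\<^esub> q) j mod int (a j) =
        \<phi> p j mod int (a j) \<otimes>\<^bsub>integer_mod_group (a j)\<^esub> (\<phi> q j mod int (a j))"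
      using mult[of p q j] that by (simp add: mod_eq_dvd_iff mod_add_eq)
  qed (simp add: carrier_integer_mod_group_iff)
  have pow_mem: "p [^]\<^bsub>F\<^esub> z \<in> P" if "p \<in> P" for p and z :: int
    using F.subgroup_int_pow_closed[OF P that] .
  have pow: "int (a j) dvd \<phi> (p [^]\<^bsub>F\<^esub> z) j - z * \<phi> p j" if "p \<in> P" "j < d" for p j and z :: int
    using hom_int_pow[OF hom[OF that(2)] _ F.subgroup_imp_group[OF P] group_integer_mod_group, of p z] that
      F.int_pow_consistent[OF P that(1), of z]
    by (simp add: int_pow_integer_mod_group mod_mult_right_eq mod_eq_dvd_iff)
  have "\<exists>p\<in>P. \<forall>j<d. int (a j) dvd \<phi> p j - (if j < k then c j else 0)" if "k \<le> d" for k
    using that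
  proof (induction k)
    case 0
    have "int (a j) dvd \<phi> \<one>\<^bsub>F\<^esub> j" if "j < d" for j
      using mult[of "\<one>\<^bsub>F\<^esub>" "\<one>\<^bsub>F\<^esub>" j] that by simp
    then show ?case by (intro bexI[of _ "\<one>\<^bsub>F\<^esub>"]) auto
  next
    case (Suc k)
    then obtain p where p: "p \<in> P" "\<And>j. j < d \<Longrightarrow> int (a j) dvd \<phi> p j - (if j < k then c j else 0)"
      by auto
    obtain e where e: "e \<in> P" "\<And>j. j < d \<Longrightarrow> int (a j) dvd \<phi> e j - (if j = k then 1 else 0)"
      using co Suc.prems by (auto simp: coords_def Suc_le_eq)
    let ?e = "e [^]\<^bsub>F\<^esub> c k"
    have "int (a j) dvd \<phi> (p \<otimes>\<^bsub>F\<^esub> ?e) j - (if j < Suc k then c j else 0)" if j: "j < d" for j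
    proof -
      let ?u = "if j < k then c j else 0" and ?v = "if j = k then 1 else 0 :: int"
      have "int (a j) dvd (\<phi> (p \<otimes>\<^bsub>F\<^esub> ?e) j - (\<phi> p j + \<phi> ?e j)) + (\<phi> p j - ?u)
          + (\<phi> ?e j - c k * \<phi> e j) + c k * (\<phi> e j - ?v)"
        by (rule dvd_add[OF dvd_add[OF dvd_add[OF mult[OF p(1) pow_mem[OF e(1)] j] p(2)[OF j]]
                pow[OF e(1) j]] dvd_mult[OF e(2)[OF j]]])
      also have "\<dots> = \<phi> (p \<otimes>\<^bsub>F\<^esub> ?e) j - (if j < Suc k then c j else 0)"
        by (auto simp: algebra_simps less_Suc_eq)
      finally show ?thesis .
    qed
    then show ?case using p(1) pow_mem[OF e(1)] by blast
  qed
  from this[of d] show ?thesis by auto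
qed

text \<open>Coordinates are grouped into blocks of equal modulus, some possibly empty. Reduced
  blockwise, they form a surjective homomorphism with kernel \<open>N\<close>.\<close>

lemma coords_iso:
  fixes m k :: nat and n h :: "nat \<Rightarrow> nat"
  assumes F: "group F" and P: "subgroup P F" and NP: "N \<subseteq> P"
    and h: "mono h"
    and co: "coords F P N (h (m + k)) b \<phi>"
    and b0: "\<And>q. q < h m \<Longrightarrow> b q = 0"
    and b: "\<And>i q. i \<in> {1..k} \<Longrightarrow> h (m + i - 1) \<le> q \<Longrightarrow> q < h (m + i) \<Longrightarrow> b q = n i"
  shows "F\<lparr>carrier := P\<rparr> Mod N \<cong> direct_power integer_group (h m) \<times>\<times>
    sum_group {1..k} (\<lambda>i. direct_power (integer_mod_group (n i)) (h (m + i) - h (m + i - 1)))"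
proof -
  let ?r = "\<lambda>i. h (m + i) - h (m + i - 1)"
  let ?A = "\<lambda>i. direct_power (integer_mod_group (n i)) (?r i)"
  let ?T1 = "direct_power integer_group (h m)" and ?T2 = "sum_group {1..k} ?A"
  let ?T = "?T1 \<times>\<times> ?T2"
  let ?FP = "F\<lparr>carrier := P\<rparr>"
  interpret F: group F by fact
  interpret P: subgroup P F by fact
  have T2: "x \<in> carrier ?T2 \<longleftrightarrow> x \<in> extensional {1..k} \<and> (\<forall>i\<in>{1..k}. x i \<in> carrier (?A i))" for x
    by (auto simp: carrier_sum_group PiE_iff)
  have T: "group ?T" by (intro DirProd_group) simp_all
  have h_le: "h (m + i) \<le> h (m + k)" if "i \<le> k" for i
    using h that by (simp add: mono_def)
  have q_less: "h (m + i - 1) + r < h (m + k)" "b (h (m + i - 1) + r) = n i"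
    if "i \<in> {1..k}" "r < ?r i" for i r
    using that h_le[of i] b[OF that(1), of "h (m + i - 1) + r"] by auto
  have mult: "int (b q) dvd \<phi> (x \<otimes>\<^bsub>F\<^esub> y) q - (\<phi> x q + \<phi> y q)"
    if "x \<in> P" "y \<in> P" "q < h (m + k)" for x y q
    using co that by (auto simp: coords_def)
  have block: "\<exists>i\<in>{1..k}. h (m + i - 1) \<le> q \<and> q < h (m + i)" if "h m \<le> q" "q < h (m + k)" for q
  proof -
    define i where "i = (LEAST i. q < h (m + i))"
    have i: "q < h (m + i)" "i \<le> k"
      unfolding i_def using that by (auto intro: LeastI Least_le)
    then have "i \<noteq> 0" using that by (cases i) auto
    moreover have "\<not> q < h (m + (i - 1))"
      using \<open>i \<noteq> 0\<close> unfolding i_def by (intro not_less_Least) simp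
    ultimately show ?thesis using i by (intro bexI[of _ i]) auto
  qed
  \<comment> \<open>The least \<open>j\<close> with \<open>q < h (m + j)\<close> is the block of
    \<open>q\<close>, even when \<open>h\<close> is constant for a while and blocks are
    empty.\<close>
  have block_unique: "(LEAST j. h (m + i - 1) + r < h (m + j)) = i" if "i \<in> {1..k}" "r < ?r i" for i r
  proof (rule Least_equality)
    show "h (m + i - 1) + r < h (m + i)" using that by simp
    fix j assume j: "h (m + i - 1) + r < h (m + j)"
    show "i \<le> j"
    proof (rule ccontr)
      assume "\<not> i \<le> j"
      then have "h (m + j) \<le> h (m + i - 1)" using h by (intro monoD[OF h]) simp
      with j show False by simp
    qed
  qed
  define \<Phi> where "\<Phi> p = (\<lambda>q\<in>{..<h m}. \<phi> p q,
    \<lambda>i\<in>{1..k}. \<lambda>r\<in>{..<?r i}. \<phi> p (h (m + i - 1) + r) mod int (n i))" for p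
  have \<Phi>_hom: "\<Phi> \<in> hom ?FP ?T"
  proof (rule homI)
    fix x assume "x \<in> carrier ?FP"
    have "fst (\<Phi> x) \<in> carrier ?T1" "snd (\<Phi> x) \<in> carrier ?T2"
      unfolding T2 direct_power_integer_group by (simp_all add: \<Phi>_def direct_power_integer_mod_group)
    then show "\<Phi> x \<in> carrier ?T" by (simp only: carrier_DirProd mem_Times_iff)
  next
    fix x y assume "x \<in> carrier ?FP" "y \<in> carrier ?FP"
    then have xy: "x \<in> P" "y \<in> P" by simp_all
    have "\<phi> (x \<otimes>\<^bsub>F\<^esub> y) q = \<phi> x q + \<phi> y q" if "q < h m" for q
      using mult[OF xy, of q] b0[OF that] that h_le[of 0] by simp
    moreover have "\<phi> (x \<otimes>\<^bsub>F\<^esub> y) (h (m + i - 1) + r) mod int (n i) =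
        (\<phi> x (h (m + i - 1) + r) mod int (n i) + \<phi> y (h (m + i - 1) + r) mod int (n i)) mod int (n i)"
      if "i \<in> {1..k}" "r < ?r i" for i r
      using mult[OF xy q_less(1)[OF that]] q_less(2)[OF that] by (simp add: mod_add_eq mod_eq_dvd_iff)
    ultimately show "\<Phi> (x \<otimes>\<^bsub>?FP\<^esub> y) = \<Phi> x \<otimes>\<^bsub>?T\<^esub> \<Phi> y"
      by (simp add: \<Phi>_def direct_power_def fun_eq_iff del: atLeastAtMost_iff)
  qed
  have kernel: "kernel ?FP ?T \<Phi> = N"
  proof -
    have "\<Phi> p = \<one>\<^bsub>?T\<^esub> \<longleftrightarrow> p \<in> N" if p: "p \<in> P" for p
    proof -
      have "\<Phi> p = \<one>\<^bsub>?T\<^esub> \<longleftrightarrow> (\<forall>q<h m. \<phi> p q = 0) \<and>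
          (\<forall>i\<in>{1..k}. \<forall>r<?r i. int (n i) dvd \<phi> p (h (m + i - 1) + r))"
        by (simp add: \<Phi>_def direct_power_def fun_eq_iff restrict_def dvd_eq_mod_eq_0
            del: atLeastAtMost_iff) blast
      also have "\<dots> \<longleftrightarrow> (\<forall>q<h (m + k). int (b q) dvd \<phi> p q)"
      proof safe
        fix q assume *: "\<forall>q<h m. \<phi> p q = 0"
          "\<forall>i\<in>{1..k}. \<forall>r<?r i. int (n i) dvd \<phi> p (h (m + i - 1) + r)" "q < h (m + k)"
        show "int (b q) dvd \<phi> p q"
        proof (cases "q < h m")
          case False
          then obtain i where i: "i \<in> {1..k}" "h (m + i - 1) \<le> q" "q < h (m + i)"
            using block[of q] * by auto
          then have "int (n i) dvd \<phi> p (h (m + i - 1) + (q - h (m + i - 1)))"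
            using *(2) by (metis diff_less_mono)
          then show ?thesis using b[OF i] i by simp
        qed (use * in simp)
      next
        fix q assume "\<forall>q<h (m + k). int (b q) dvd \<phi> p q" "q < h m"
        then show "\<phi> p q = 0" using h_le[of 0] b0[of q] by (auto dest!: spec[of _ q])
      next
        fix i r assume *: "\<forall>q<h (m + k). int (b q) dvd \<phi> p q" "i \<in> {1..k}" "r < ?r i"
        show "int (n i) dvd \<phi> p (h (m + i - 1) + r)"
          using *(1) q_less[OF *(2,3)] by metis
      qed
      also have "\<dots> \<longleftrightarrow> p \<in> N"
        using co p by (auto simp: coords_def)
      finally show ?thesis .
    qed
    then show ?thesis using NP by (auto simp: kernel_def)
  qed
  have surj: "\<Phi> ` carrier ?FP = carrier ?T"
  proof
    show "\<Phi> ` carrier ?FP \<subseteq> carrier ?T"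
      using hom_in_carrier[OF \<Phi>_hom] by blast
    show "carrier ?T \<subseteq> \<Phi> ` carrier ?FP"
    proof
      fix t assume t: "t \<in> carrier ?T"
      obtain f g where [simp]: "t = (f, g)" by (cases t)
      have f: "f \<in> extensional {..<h m}" and g: "g \<in> extensional {1..k}"
        and gi: "\<And>i. i \<in> {1..k} \<Longrightarrow> g i \<in> extensional {..<?r i} \<and> (\<forall>r<?r i. g i r mod int (n i) = g i r)"
      proof -
        have "f \<in> carrier ?T1" "g \<in> carrier ?T2"
          using t by (simp_all only: \<open>t = (f, g)\<close> carrier_DirProd mem_Sigma_iff)
        then show "f \<in> extensional {..<h m}" "g \<in> extensional {1..k}"
          "\<And>i. i \<in> {1..k} \<Longrightarrow> g i \<in> extensional {..<?r i} \<and> (\<forall>r<?r i. g i r mod int (n i) = g i r)"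
          unfolding T2 direct_power_integer_group direct_power_integer_mod_group by blast+
      qed
      \<comment> \<open>\<open>t\<close> written as one vector; the position of \<open>q\<close>
        within its block is its distance from the start of the block.\<close>
      define c where "c q = (if q < h m then f q else
        (let i = LEAST i. q < h (m + i) in g i (q - h (m + i - 1))))" for q
      obtain p where p: "p \<in> P" "\<And>q. q < h (m + k) \<Longrightarrow> int (b q) dvd \<phi> p q - c q"
        using coords_surj[OF F P co, of c] by blast
      have "\<phi> p q = f q" if "q < h m" for q
        using p(2)[of q] b0[OF that] that h_le[of 0] by (simp add: c_def)
      moreover have "\<phi> p (h (m + i - 1) + r) mod int (n i) = g i r" if ir: "i \<in> {1..k}" "r < ?r i" for i r
      proof -
        have "m \<le> m + i - 1" using ir by auto
        then have "h m \<le> h (m + i - 1)" by (rule monoD[OF h])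
        then have "c (h (m + i - 1) + r) = g i r"
          using block_unique[OF ir] by (simp add: c_def)
        then have "\<phi> p (h (m + i - 1) + r) mod int (n i) = g i r mod int (n i)"
          using p(2)[OF q_less(1)[OF ir]] q_less(2)[OF ir] by (simp add: mod_eq_dvd_iff)
        then show ?thesis using gi[OF ir(1)] ir(2) by simp
      qed
      ultimately have "\<Phi> p = t"
        using f g gi by (auto simp: \<Phi>_def fun_eq_iff extensional_def)
      then show "t \<in> \<Phi> ` carrier ?FP" using p(1) by (intro image_eqI[of t \<Phi> p]) simp_all
    qed
  qed
  have "group_hom ?FP ?T \<Phi>"
    using \<Phi>_hom T F.subgroup_imp_group[OF P] by (simp add: group_hom_def group_hom_axioms_def)
  from group_hom.FactGroup_iso[OF this surj] show ?thesis
    unfolding kernel .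
qed

text \<open>Comparing \<open>\<phi>\<close> on \<open>p q = [p,q] (q p)\<close> and on
  \<open>q p\<close> leaves its value at \<open>[p,q]\<close> divisible by every modulus.\<close>

lemma coords_derived_subset:
  assumes F: "group F" and P: "subgroup P F" and N: "subgroup N F" and co: "coords F P N d a \<phi>"
  shows "derived F P \<subseteq> N"
proof -
  interpret F: group F by fact
  interpret P: subgroup P F by fact
  have mult: "int (a j) dvd \<phi> (p \<otimes>\<^bsub>F\<^esub> q) j - (\<phi> p j + \<phi> q j)" if "p \<in> P" "q \<in> P" "j < d" for p q j
    using co that by (auto simp: coords_def)
  have "commutator F p q \<in> N" if pq: "p \<in> P" "q \<in> P" for p q
  proof -
    have c: "commutator F p q \<in> P" using pq by (simp add: commutator_def)
    have "int (a j) dvd \<phi> (commutator F p q) j" if j: "j < d" for j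
    proof -
      show ?thesis
        using dvd_diff[OF dvd_diff[OF mult[OF pq j] mult[OF pq(2,1) j]]
            mult[OF c P.m_closed[OF pq(2,1)] j]] pq
        by (simp add: F.commutator_mult_swap algebra_simps)
    qed
    then show ?thesis using co c by (auto simp: coords_def)
  qed
  then show ?thesis
    unfolding F.derived_eq_commutator_subgroup by (rule F.commutator_subgroup_subset[OF N])
qed

section \<open>Location of the blocks of equal moduli\<close>

lemma pair_snd_pow_less: "q < h_exp l i \<Longrightarrow> (pair_snd ^^ l) q < i"
proof (induction l arbitrary: q)
  case (Suc l)
  have "pair_snd q < h_exp l i"
    using Suc.prems by (intro pair_snd_less) (simp add: h_exp_def)
  then show ?case using Suc.IH by (simp add: funpow_swap1)
qed (simp add: h_exp_def)

text \<open>Together with \<open>pair_snd_pow_less\<close>: the indices from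
  \<open>h_exp l i\<close> up to, but excluding, \<open>h_exp l (i + 1)\<close> are those sent to
  \<open>i\<close>, so they share the modulus \<open>a i\<close>.\<close>

lemma pair_snd_pow_ge: "h_exp l i \<le> q \<Longrightarrow> i \<le> (pair_snd ^^ l) q"
proof (induction l arbitrary: q)
  case (Suc l)
  have "h_exp l i \<le> pair_snd q"
  proof (rule ccontr)
    assume "\<not> ?thesis"
    then have "chi2 (Suc (pair_snd q)) \<le> h_exp (Suc l) i"
      unfolding h_exp_def by (simp add: chi2_mono)
    then show False using Suc.prems pair_snd_upper[of q] by simp
  qed
  then show ?case using Suc.IH by (simp add: funpow_swap1)
qed (simp add: h_exp_def)

theorem corollary2p4:
  fixes l m k :: nat and n :: "nat \<Rightarrow> nat" and V :: "nat word set"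
    and G :: "'g monoid" and F :: "'f monoid" and R :: "'f set"
  assumes "1 \<le> l"
    and "defines_solvable_variety V l"
    and "group G"
    and "\<forall>i\<in>{1..k}. 0 < n i"
    and "\<forall>i\<in>{1..<k}. n (i + 1) dvd n i"
    and "G \<cong> direct_power integer_group m \<times>\<times> sum_group {1..k} (\<lambda>i. integer_mod_group (n i))"
    and "free_presentation F R G"
  shows "baer_invariant F R V \<cong>
    direct_power integer_group (h_exp l m) \<times>\<times>
    sum_group {1..k} (\<lambda>i. direct_power (integer_mod_group (n i)) (h_exp l (m + i) - h_exp l (m + i - 1)))"
proof -
  obtain S where F: "group F" "free_basis F S" and R: "R \<lhd> F" and GR: "G \<cong> F Mod R"
    using assms(7) by (auto simp: free_presentation_def free_group_def)
  interpret F: group F by fact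
  have "F Mod R \<cong> direct_power integer_group m \<times>\<times> sum_group {1..k} (\<lambda>i. integer_mod_group (n i))"
    using iso_trans[OF group.iso_sym[OF assms(3) GR] assms(6)] .
  define a where "a j = (if j < m then 0 else n (Suc j - m))" for j
  obtain \<phi> where \<phi>: "coords F (carrier F) R (m + k) a \<phi>"
    using coords_of_iso[OF F(1) R \<open>F Mod R \<cong> _\<close>] unfolding a_def[abs_def] by blast
  have n_dvd: "n j dvd n i" if "i \<le> j" "1 \<le> i" "j \<le> k" for i j
    using that
  proof (induction rule: dec_induct)
    case (step j)
    then have "n (Suc j) dvd n j" using assms(5) by simp
    then show ?case using step dvd_trans by auto
  qed simp
  have a_dvd: "a j dvd a i" if "i \<le> j" "j < m + k" for i j
    using that by (auto simp: a_def intro!: n_dvd)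
  let ?P = "(derived F ^^ l) (carrier F)" and ?N = "solvable_commutator F R l"
  obtain \<psi> where \<psi>: "coords F ?P ?N (h_exp l (m + k)) (a \<circ> (pair_snd ^^ l)) \<psi>"
    using coords_derived_series[OF F R a_dvd \<phi>] by blast
  \<comment> \<open>\<open>l \<ge> 1\<close> places \<open>?P\<close> inside the first derived
    subgroup, which lies in \<open>R\<close> because \<open>F Mod R\<close> is abelian. The
    numerator \<open>R \<inter> ?P\<close> is therefore \<open>?P\<close>.\<close>
  have "?P \<subseteq> derived F (carrier F)"
    using \<open>1 \<le> l\<close>
  proof (induction rule: dec_induct)
    case (step l)
    have "derived F ((derived F ^^ l) (carrier F)) \<subseteq> (derived F ^^ l) (carrier F)"
      by (intro F.derived_incl F.exp_of_derived_is_subgroup F.subgroup_self) simp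
    then show ?case using step.IH by simp
  qed simp
  also have "\<dots> \<subseteq> R"
    by (rule coords_derived_subset[OF F(1) F.subgroup_self normal_imp_subgroup[OF R] \<phi>])
  finally have "R \<inter> ?P = ?P" by blast
  then have "baer_invariant F R V = F\<lparr>carrier := ?P\<rparr> Mod ?N"
    unfolding baer_invariant_def F.verbal_subgroup_solvable[OF assms(2)]
      F.baer_commutator_solvable[OF R assms(2)] by simp
  also have "\<dots> \<cong> direct_power integer_group (h_exp l m) \<times>\<times>
    sum_group {1..k} (\<lambda>i. direct_power (integer_mod_group (n i)) (h_exp l (m + i) - h_exp l (m + i - 1)))"
  proof (rule coords_iso[OF F(1) normal_imp_subgroup[OF F.derived_series_normal]
        F.solvable_commutator_subset[OF R] mono_h_exp \<psi>])
    show "(a \<circ> (pair_snd ^^ l)) q = 0" if "q < h_exp l m" for q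
      using pair_snd_pow_less[OF that] by (simp add: a_def)
    show "(a \<circ> (pair_snd ^^ l)) q = n i"
      if "i \<in> {1..k}" "h_exp l (m + i - 1) \<le> q" "q < h_exp l (m + i)" for i q
    proof -
      have "(pair_snd ^^ l) q = m + i - 1"
        using pair_snd_pow_ge[OF that(2)] pair_snd_pow_less[OF that(3)] by simp
      moreover have "m \<le> m + i - 1" "Suc (m + i - 1) - m = i" using that(1) by auto
      ultimately show ?thesis by (simp add: a_def del: One_nat_def)
    qed
  qed
  finally show ?thesis .
qed

end
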